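(* Let $k$ be an integer and let $(E_N)_{N\in\mathbb{N}}$ and $(F_N)_{N\in\mathbb{N}}$ be two elements of $\prod_{N\in\mathbb{N}}\mathbb{C}[\mathcal{P}_k(N)]$ which converge (in moments). Then the sequence $(E_NF_N)_{N\in\mathbb{N}}$ (product in $\mathbb{C}[\mathcal{P}_k(N)]$) converges (in moments). Besides, $$\phi_{EF}^{\kappa}=\phi_E^{\kappa}\boxtimes\phi_F^{\kappa},\qquad \phi_{EF}^{m}=\phi_E^{\kappa}\boxtimes_d^m\phi_F^{m},\qquad \phi_{EF}^{m}=\phi_E^{m}\boxtimes_g^m\phi_F^{\kappa}.$$
   Context: $\mathcal{P}_k$ is the set of partitions of $\{1,\dots,k\}\cup\{1',\dots,k'\}$ ($1,\dots,k$ top row, $1',\dots,k'$ bottom row), $\mathrm{id}_k=\{\{i,i'\}:1\le i\le k\}$. $\mathrm{nc}(p)$ is the number of blocks, $p\vee p'$ the finest partition coarser than both, $d(p,p')=\frac12(\mathrm{nc}(p)+\mathrm{nc}(p'))-\mathrm{nc}(p\vee p')$, and $p'\leq p$ if $d(\mathrm{id}_k,p')+d(p',p)=d(\mathrm{id}_k,p)$. Composition: $p\circ p'$ is obtained by putting a diagram of $p'$ above one of $p$, identifying the bottom vertex $i'$ of $p'$ with the top vertex $i$ of $p$, and taking the partition of top and bottom rows induced by the connected components; $\kappa(p,p')$ is the number of connected components entirely contained in the middle row. ${}^tp$ is $p$ with $i$ and $i'$ exchanged for all $i$. The partition algebra $\mathbb{C}[\mathcal{P}_k(N)]$ has basis $\mathcal{P}_k$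 and product $p_1p_2=N^{\kappa(p_1,p_2)}(p_1\circ p_2)$; $\mathrm{Tr}_N$ is the linear form with $\mathrm{Tr}_N(p)=N^{\mathrm{nc}(p\vee\mathrm{id}_k)}$. For $E\in\mathbb{C}[\mathcal{P}_k(N)]$: $m_p(E)=\frac{1}{\mathrm{Tr}_N(p)}\mathrm{Tr}_N(E\,{}^tp)$ and $\kappa_p(E)=N^{\mathrm{nc}(p)-\mathrm{nc}(p\vee\mathrm{id}_k)}E_p$, $E_p$ being the coordinate of $E$ on $p$. $(E_N)_N$ converges (in moments) if $m_p(E_N)$ converges for every $p\in\mathcal{P}_k$; then $\kappa_p(E_N)$ converges for every $p$ as well, and one denotes by $\phi_E^m,\phi_E^\kappa\in(\mathbb{C}[\mathcal{P}_k])^*$ the linear forms with $\phi_E^m(p)=\lim_Nm_p(E_N)$, $\phi_E^{\kappa}(p)=\lim_N\kappa_p(E_N)$. $\phi_{EF}^m,\phi_{EF}^\kappa$ are the forms associated in the same way with $(E_NF_N)_N$. For $p,p'\in\mathcal{P}_k$, $\mathsf{K}_p(p')$ is the set of $p''\in\mathcal{P}_k$ such that $p=p'\circ p''$ and $d(\mathrm{id}_k,p)=d(\mathrm{id}_k,p')+d(\mathrm{id}_k,p'')-\frac{k+\mathrm{nc}(p)-\mathrm{nc}(p')-\mathrm{nc}(p'')}{2}-\kappa(p',p'')$. For $\phi_1,\phi_2\in(\mathbb{C}[\mathcal{P}_k])^*$ and $p\in\mathcal{P}_k$, $$(\phi_1\boxtimes\phi_2)(p)=\sum_{p_1\circ p_2=p,\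 p_2\in\mathsf{K}_{p}(p_1)}\phi_1(p_1)\phi_2(p_2),$$ $$(\phi_1\boxtimes_d^m\phi_2)(p)=\sum_{p_1\leq p}\phi_1(p_1)\phi_2({}^tp_1\circ p),\qquad (\phi_1\boxtimes_g^m\phi_2)(p)=\sum_{p_1\leq p}\phi_1(p\circ{}^tp_1)\phi_2(p_1).$$ *)

theory Defs
  imports Complex_Main "HOL-Library.Disjoint_Sets"
begin

section \<open>Partitions\<close>

text \<open>
  Vertices are pairs (row, index): \<open>(Top, i)\<close> is the vertex i and \<open>(Bot, i)\<close> the vertex i'.
  The row \<open>Mid\<close> is used only in the three-row diagrams that define composition.
\<close>

datatype level = Top | Mid | Bot

type_synonym vertex = "level \<times> nat"
type_synonym diag = "vertex set set"

definition vertices :: "nat \<Rightarrow> vertex set" where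
  "vertices k = {Top, Bot} \<times> {1..k}"

definition Parts :: "nat \<Rightarrow> diag set" where
  "Parts k = {p. partition_on (vertices k) p}"

definition id_part :: "nat \<Rightarrow> diag" where
  "id_part k = (\<lambda>i. {(Top, i), (Bot, i)}) ` {1..k}"

definition nc :: "diag \<Rightarrow> nat" where
  "nc p = card p"

definition is_join :: "nat \<Rightarrow> diag \<Rightarrow> diag \<Rightarrow> diag \<Rightarrow> bool" where
  "is_join k p q r \<longleftrightarrow>
     refines (vertices k) p r \<and> refines (vertices k) q r \<and>
     (\<forall>s. refines (vertices k) p s \<and> refines (vertices k) q s \<longrightarrow> refines (vertices k) r s)"

definition join :: "nat \<Rightarrow> diag \<Rightarrow> diag \<Rightarrow> diag" where
  "join k p q = (THE r. is_join k p q r)"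

lemma ex1_join:
  assumes "p \<in> Parts k" "q \<in> Parts k"
  shows "\<exists>!r. is_join k p q r"
proof -
  let ?A = "vertices k"
  let ?S = "{s. refines ?A p s \<and> refines ?A q s}"
  have part: "\<And>s. s \<in> ?S \<Longrightarrow> partition_on ?A s"
    by (auto simp: refines_def)
  have pq: "partition_on ?A p" "partition_on ?A q"
    using assms by (auto simp: Parts_def)
  have ne: "?S \<noteq> {}"
  proof (cases "?A = {}")
    case True
    then show ?thesis using pq by (simp add: partition_on_empty refines_def)
  next
    case False
    then have "{?A} \<in> ?S"
      using pq partition_on_space[OF False] by (auto simp: refines_def partition_on_def)
    then show ?thesis by blast
  qed
  let ?r = "common_refinement ?S"
  have 1: "refines ?A p ?r"
    by (rule common_refinement_coarsest[OF part pq(1) _ ne]) blast+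
  have 2: "refines ?A q ?r"
    by (rule common_refinement_coarsest[OF part pq(2) _ ne]) blast+
  have 3: "refines ?A ?r s" if "s \<in> ?S" for s
    using refines_common_refinement[OF part that] .
  have r: "is_join k p q ?r"
    unfolding is_join_def using 1 2 3 by simp
  show ?thesis
  proof (rule ex1I[where P = "is_join k p q", OF r])
    fix r assume "is_join k p q r"
    with r have "refines ?A r ?r" "refines ?A ?r r"
      unfolding is_join_def by simp_all
    then show "r = ?r"
      by (rule refines_asym)
  qed
qed

definition pdist :: "nat \<Rightarrow> diag \<Rightarrow> diag \<Rightarrow> real" where
  "pdist k p q = (real (nc p) + real (nc q)) / 2 - real (nc (join k p q))"

text \<open>\<open>geo_le k q p\<close> is the relation \<open>q \<le> p\<close>.\<close>

definition geo_le :: "nat \<Rightarrow> diag \<Rightarrow> diag \<Rightarrow> bool" where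
  "geo_le k q p \<longleftrightarrow>
     pdist k (id_part k) q + pdist k q p = pdist k (id_part k) p"


section \<open>Composition and transposition\<close>

text \<open>
  For \<open>p \<circ> p'\<close>, the partition \<open>p'\<close> is placed on the rows Top, Mid and \<open>p\<close> on the rows
  Mid, Bot, so that the bottom row of \<open>p'\<close> is identified with the top row of \<open>p\<close>.
\<close>

definition place_above :: "vertex \<Rightarrow> vertex" where
  "place_above = (\<lambda>(l, i). (if l = Bot then Mid else l, i))"

definition place_below :: "vertex \<Rightarrow> vertex" where
  "place_below = (\<lambda>(l, i). (if l = Top then Mid else l, i))"

definition stacked_edges :: "diag \<Rightarrow> diag \<Rightarrow> (vertex \<times> vertex) set" where
  "stacked_edges p p' =
     (\<Union>B \<in> (`) place_above ` p' \<union> (`) place_below ` p. B \<times> B)"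

definition stack_components :: "nat \<Rightarrow> diag \<Rightarrow> diag \<Rightarrow> vertex set set" where
  "stack_components k p p' = ({Top, Mid, Bot} \<times> {1..k}) // (stacked_edges p p')\<^sup>*"

definition pcomp :: "nat \<Rightarrow> diag \<Rightarrow> diag \<Rightarrow> diag" where
  "pcomp k p p' = (\<lambda>C. C \<inter> vertices k) ` stack_components k p p' - {{}}"

definition loops :: "nat \<Rightarrow> diag \<Rightarrow> diag \<Rightarrow> nat" where
  "loops k p p' = card {C \<in> stack_components k p p'. C \<subseteq> {Mid} \<times> {1..k}}"

fun flip :: "vertex \<Rightarrow> vertex" where
  "flip (Top, i) = (Bot, i)"
| "flip (Bot, i) = (Top, i)"
| "flip (Mid, i) = (Mid, i)"

definition ptranspose :: "diag \<Rightarrow> diag" where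
  "ptranspose p = (`) flip ` p"


section \<open>The partition algebra\<close>

text \<open>
  A vector is represented by its coordinates on the basis \<open>Parts k\<close>. The underlying vector space
  does not depend on N; the product and the trace do.
\<close>

type_synonym pvec = "diag \<Rightarrow> complex"

definition palg :: "nat \<Rightarrow> pvec set" where
  "palg k = {x. \<forall>p. p \<notin> Parts k \<longrightarrow> x p = 0}"

definition basis :: "diag \<Rightarrow> pvec" where
  "basis p = (\<lambda>q. if q = p then 1 else 0)"

definition pmult :: "nat \<Rightarrow> nat \<Rightarrow> pvec \<Rightarrow> pvec \<Rightarrow> pvec" where
  "pmult k N x y = (\<lambda>q. \<Sum>p1\<in>Parts k. \<Sum>p2\<in>Parts k.
     x p1 * y p2 * (of_nat N ^ loops k p1 p2 * basis (pcomp k p1 p2) q))"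

text \<open>The linear form taking the value \<open>f p\<close> on each basis vector \<open>p\<close>.\<close>

definition lin_form :: "nat \<Rightarrow> (diag \<Rightarrow> complex) \<Rightarrow> pvec \<Rightarrow> complex" where
  "lin_form k f = (\<lambda>x. \<Sum>p\<in>Parts k. x p * f p)"

definition Tr :: "nat \<Rightarrow> nat \<Rightarrow> pvec \<Rightarrow> complex" where
  "Tr k N = lin_form k (\<lambda>p. of_nat N ^ nc (join k p (id_part k)))"

definition moment :: "nat \<Rightarrow> nat \<Rightarrow> diag \<Rightarrow> pvec \<Rightarrow> complex" where
  "moment k N p x =
     1 / Tr k N (basis p) * Tr k N (pmult k N x (basis (ptranspose p)))"

definition cumulant :: "nat \<Rightarrow> nat \<Rightarrow> diag \<Rightarrow> pvec \<Rightarrow> complex" where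
  "cumulant k N p x =
     of_nat N powi (int (nc p) - int (nc (join k p (id_part k)))) * x p"

definition converges_in_moments :: "nat \<Rightarrow> (nat \<Rightarrow> pvec) \<Rightarrow> bool" where
  "converges_in_moments k E \<longleftrightarrow> (\<forall>p\<in>Parts k. convergent (\<lambda>N. moment k N p (E N)))"

text \<open>Both limits below exist for every \<open>p \<in> Parts k\<close> when \<open>E\<close> converges in moments.\<close>

definition phi_m :: "nat \<Rightarrow> (nat \<Rightarrow> pvec) \<Rightarrow> pvec \<Rightarrow> complex" where
  "phi_m k E = lin_form k (\<lambda>p. lim (\<lambda>N. moment k N p (E N)))"

definition phi_kappa :: "nat \<Rightarrow> (nat \<Rightarrow> pvec) \<Rightarrow> pvec \<Rightarrow> complex" where
  "phi_kappa k E = lin_form k (\<lambda>p. lim (\<lambda>N. cumulant k N p (E N)))"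


section \<open>Convolutions of linear forms\<close>

text \<open>\<open>Kset k p p'\<close> is the set written \<open>K\<^sub>p(p')\<close>.\<close>

definition Kset :: "nat \<Rightarrow> diag \<Rightarrow> diag \<Rightarrow> diag set" where
  "Kset k p p' = {p'' \<in> Parts k.
     p = pcomp k p' p'' \<and>
     pdist k (id_part k) p =
       pdist k (id_part k) p' + pdist k (id_part k) p''
       - (real k + real (nc p) - real (nc p') - real (nc p'')) / 2
       - real (loops k p' p'')}"

definition boxtimes :: "nat \<Rightarrow> (pvec \<Rightarrow> complex) \<Rightarrow> (pvec \<Rightarrow> complex) \<Rightarrow> pvec \<Rightarrow> complex" where
  "boxtimes k \<phi>1 \<phi>2 = lin_form k (\<lambda>p.
     \<Sum>(p1, p2) \<in> {(p1, p2) \<in> Parts k \<times> Parts k. pcomp k p1 p2 = p \<and> p2 \<in> Kset k p p1}.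
       \<phi>1 (basis p1) * \<phi>2 (basis p2))"

definition boxtimes_dm :: "nat \<Rightarrow> (pvec \<Rightarrow> complex) \<Rightarrow> (pvec \<Rightarrow> complex) \<Rightarrow> pvec \<Rightarrow> complex" where
  "boxtimes_dm k \<phi>1 \<phi>2 = lin_form k (\<lambda>p.
     \<Sum>p1 \<in> {p1 \<in> Parts k. geo_le k p1 p}.
       \<phi>1 (basis p1) * \<phi>2 (basis (pcomp k (ptranspose p1) p)))"

definition boxtimes_gm :: "nat \<Rightarrow> (pvec \<Rightarrow> complex) \<Rightarrow> (pvec \<Rightarrow> complex) \<Rightarrow> pvec \<Rightarrow> complex" where
  "boxtimes_gm k \<phi>1 \<phi>2 = lin_form k (\<lambda>p.
     \<Sum>p1 \<in> {p1 \<in> Parts k. geo_le k p1 p}.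
       \<phi>1 (basis (pcomp k p (ptranspose p1))) * \<phi>2 (basis p1))"

end

(* Closing the composition of p1 and p2 on its two outer rows by a third partition p gives a diagram on
   three rows whose number of components is loops + nc ((p1 o p2) v p). This number is invariant under
   rotating and reflecting the three partitions, so that Tr (p q^t) = N^nc(p v q), and moments are
   cumulants multiplied by the matrix N^-(d(id,q) + d(q,p) - d(id,p)). Since the number of components is
   submodular, the exponents are nonpositive: the matrix tends to the zeta matrix of the order <=, which
   is invertible because d is a distance, so that convergence of moments and of cumulants is the same.
   The same symmetries write the moments and cumulants of a product as finite sums of products of moments
   and cumulants of the factors weighted by nonpositive powers of N; in the limit only the terms with
   exponent 0 survive, which are the index sets of the three convolutions. *)

theory Submission
  imports Defs
begin

section \<open>Counting connected components\<close>

text \<open>Most counts rest on one fact: a new edge lowers the number of components by one exactly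
  when its ends were not yet connected. Submodularity follows, because in a graph with more
  connections fewer edges still merge components. Equalities of counts also come from maps that are
  onto on components, used in both directions or around a cycle. No matrix is inverted at finite
  \<open>N\<close>. Only the limit is: d(id, p) strictly increases along \<le>, so the zeta matrix
  is unitriangular. The obstacle is that the cumulants are not known in advance to be bounded, so an
  error matrix tending to 0 says nothing about its product with them until a bound has been
  extracted from the same equations. Identities that divide powers of \<open>N\<close> are stated
  for \<open>N > 0\<close>, which is enough for limits.\<close>

definition conn :: "('a \<times> 'a) set \<Rightarrow> ('a \<times> 'a) set" where
  "conn R = (R \<union> R\<inverse>)\<^sup>*"

text \<open>Counts the classes in the whole type that meet \<open>V\<close>. Nothing here confines
  \<open>R\<close> or these classes to \<open>V\<close>, so the comparison lemmas can leave the
  support of \<open>R\<close> open.\<close>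

definition ncomp :: "'a set \<Rightarrow> ('a \<times> 'a) set \<Rightarrow> nat" where
  "ncomp V R = card (V // conn R)"

lemma conn_refl [simp]: "(x, x) \<in> conn R"
  by (simp add: conn_def)

lemma conn_sym: "(x, y) \<in> conn R \<Longrightarrow> (y, x) \<in> conn R"
  unfolding conn_def by (rule symD[OF sym_rtrancl[OF sym_Un_converse]])

lemma conn_trans: "(x, y) \<in> conn R \<Longrightarrow> (y, z) \<in> conn R \<Longrightarrow> (x, z) \<in> conn R"
  unfolding conn_def by (rule rtrancl_trans)

lemma conn_edge: "(x, y) \<in> R \<Longrightarrow> (x, y) \<in> conn R"
  unfolding conn_def by auto

lemma equiv_conn: "equiv UNIV (conn R)"
proof (rule equivI)
  show "sym (conn R)" by (rule symI) (rule conn_sym)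
  show "trans (conn R)" by (rule transI) (rule conn_trans)
qed (auto simp: refl_on_def)

lemma conn_class_eq_iff: "conn R `` {x} = conn R `` {y} \<longleftrightarrow> (x, y) \<in> conn R"
  by (rule eq_equiv_class_iff[OF equiv_conn]) simp_all

lemma conn_induct [consumes 1, case_names refl step]:
  assumes "(a, x) \<in> conn R" and "P a"
    and "\<And>x y. (a, x) \<in> conn R \<Longrightarrow> (x, y) \<in> R \<or> (y, x) \<in> R \<Longrightarrow> P x \<Longrightarrow> P y"
  shows "P x"
  using assms(1) unfolding conn_def
proof (induction rule: rtrancl_induct)
  case base
  show ?case by fact
next
  case (step y z)
  then show ?case using assms(3)[of y z] by (auto simp: conn_def)
qed

lemma conn_map:
  assumes "(a, b) \<in> conn R"
    and "\<And>x y. (x, y) \<in> R \<Longrightarrow> (f x, f y) \<in> conn S"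
  shows "(f a, f b) \<in> conn S"
  using assms(1)
proof (induction rule: conn_induct)
  case (step x y)
  then show ?case using assms(2) conn_sym conn_trans by metis
qed simp

lemma conn_mono: "R \<subseteq> S \<Longrightarrow> conn R \<subseteq> conn S"
  unfolding conn_def by (intro rtrancl_mono) auto

lemma conn_quotient_eq: "V // conn R = (\<lambda>x. conn R `` {x}) ` V"
  by (auto simp: quotient_def)

text \<open>\<open>f\<close> induces a map on components, and \<open>surj\<close> makes it onto:
  each component of \<open>S\<close> that meets \<open>W\<close> contains the image of a point of
  \<open>V\<close>. The symmetries of diagrams below are all obtained from this inequality.\<close>

lemma ncomp_le:
  assumes "finite V"
    and surj: "\<And>w. w \<in> W \<Longrightarrow> \<exists>v\<in>V. (f v, w) \<in> conn S"
    and edge: "\<And>x y. (x, y) \<in> R \<Longrightarrow> (f x, f y) \<in> conn S"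
  shows "ncomp W S \<le> ncomp V R"
proof -
  let ?g = "\<lambda>C. conn S `` (f ` C)"
  have g: "?g (conn R `` {v}) = conn S `` {f v}" for v
  proof (intro set_eqI iffI)
    fix y assume "y \<in> ?g (conn R `` {v})"
    then obtain u where "(v, u) \<in> conn R" "(f u, y) \<in> conn S" by auto
    then show "y \<in> conn S `` {f v}" using conn_map[of v u R f S] edge conn_trans[of "f v" "f u" S y] by simp
  qed (auto intro: bexI[of _ v])
  have "W // conn S \<subseteq> ?g ` (V // conn R)"
  proof
    fix C assume "C \<in> W // conn S"
    then obtain w where w: "w \<in> W" "C = conn S `` {w}" by (auto simp: quotient_def)
    obtain v where "v \<in> V" "(f v, w) \<in> conn S" using surj[OF w(1)] by blast
    then have "C = ?g (conn R `` {v})" using w g conn_class_eq_iff by metis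
    then show "C \<in> ?g ` (V // conn R)" using \<open>v \<in> V\<close> by (auto simp: quotient_def)
  qed
  moreover have "finite (V // conn R)" using assms(1) by (simp add: conn_quotient_eq)
  ultimately show ?thesis unfolding ncomp_def by (rule surj_card_le[rotated])
qed

text \<open>A walk that crosses the new edge several times can be cut down to at most one crossing,
  in one of the two directions.\<close>

lemma conn_insert:
  "(x, y) \<in> conn (insert (a, b) R) \<longleftrightarrow>
     (x, y) \<in> conn R \<or> (x, a) \<in> conn R \<and> (b, y) \<in> conn R \<or> (x, b) \<in> conn R \<and> (a, y) \<in> conn R"
    (is "?L \<longleftrightarrow> ?P y")
proof
  assume ?L
  then show "?P y"
  proof (induction rule: conn_induct)
    case (step u v)
    show ?case
    proof (cases "(u, v) \<in> conn R")
      case True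
      then show ?thesis using step.IH unfolding conn_class_eq_iff[symmetric] by auto
    next
      case False
      then have "(u, v) \<notin> R" "(v, u) \<notin> R" using conn_edge conn_sym by metis+
      then have "u = a \<and> v = b \<or> u = b \<and> v = a" using step by auto
      then show ?thesis using step.IH by auto
    qed
  qed simp
next
  have sub: "conn R \<subseteq> conn (insert (a, b) R)" by (rule conn_mono) auto
  have ab: "(a, b) \<in> conn (insert (a, b) R)" by (rule conn_edge) simp
  assume "?P y"
  then consider "(x, y) \<in> conn R" | "(x, a) \<in> conn R" "(b, y) \<in> conn R"
    | "(x, b) \<in> conn R" "(a, y) \<in> conn R" by blast
  then show ?L
  proof cases
    case 1
    then show ?thesis using sub by blast
  next
    case 2
    then have "(x, a) \<in> conn (insert (a, b) R)" "(b, y) \<in> conn (insert (a, b) R)"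
      using sub by auto
    then show ?thesis using ab conn_trans by metis
  next
    case 3
    then have "(x, b) \<in> conn (insert (a, b) R)" "(a, y) \<in> conn (insert (a, b) R)"
      using sub by auto
    then show ?thesis using conn_sym[OF ab] conn_trans by metis
  qed
qed

text \<open>The new edge joins two points of one class or merges exactly two classes. The additive
  form avoids truncated subtraction and is the step of the inductions on edge sets below.\<close>

lemma ncomp_insert:
  assumes "finite V" "a \<in> V" "b \<in> V"
  shows "ncomp V R = ncomp V (insert (a, b) R) + of_bool ((a, b) \<notin> conn R)"
proof (cases "(a, b) \<in> conn R")
  case True
  have "(x, y) \<in> conn (insert (a, b) R) \<longleftrightarrow> (x, y) \<in> conn R" for x y
    using True unfolding conn_insert unfolding conn_class_eq_iff[symmetric] by argo
  then have "conn (insert (a, b) R) = conn R" by auto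
  then show ?thesis using True by (simp add: ncomp_def)
next
  case False
  define A B where "A = conn R `` {a}" and "B = conn R `` {b}"
  have cls: "conn (insert (a, b) R) `` {x} = (if x \<in> A \<union> B then A \<union> B else conn R `` {x})" for x
  proof (cases "x \<in> A \<union> B")
    case True
    then have "y \<in> conn (insert (a, b) R) `` {x} \<longleftrightarrow> y \<in> A \<union> B" for y
      unfolding A_def B_def Image_singleton_iff Un_iff conn_insert
      unfolding conn_class_eq_iff[symmetric]
      by argo
    then show ?thesis using True by auto
  next
    case False
    then have "(x, a) \<notin> conn R" "(x, b) \<notin> conn R"
      unfolding A_def B_def using conn_sym[of x a R] conn_sym[of x b R] by auto
    then show ?thesis using False by (auto simp: conn_insert)
  qed
  have AB: "A \<in> V // conn R" "B \<in> V // conn R" "A \<noteq> B" "a \<in> A" "b \<in> B"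
    using assms False by (auto simp: A_def B_def conn_quotient_eq conn_class_eq_iff)
  have class_if_mem: "conn R `` {x} = A \<or> conn R `` {x} = B" if "x \<in> A \<union> B" for x
    using that unfolding A_def B_def Un_iff Image_singleton_iff conn_class_eq_iff[symmetric] by auto
  have mem_if_class: "x \<in> A \<union> B" if "conn R `` {x} = A \<or> conn R `` {x} = B" for x
  proof -
    have "x \<in> conn R `` {x}" by simp
    then show ?thesis using that by (elim disjE) simp_all
  qed
  have eq: "V // conn (insert (a, b) R) = insert (A \<union> B) (V // conn R - {A, B})"
  proof (intro set_eqI iffI)
    fix C assume "C \<in> V // conn (insert (a, b) R)"
    then obtain x where x: "x \<in> V" "C = conn (insert (a, b) R) `` {x}" unfolding conn_quotient_eq by (elim imageE)
    show "C \<in> insert (A \<union> B) (V // conn R - {A, B})"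
    proof (cases "x \<in> A \<union> B")
      case True
      then show ?thesis using x(2) unfolding cls by simp
    next
      case False
      then have "C = conn R `` {x}" "C \<noteq> A" "C \<noteq> B" using x(2) mem_if_class[of x] cls[of x] by metis+
      then show ?thesis using x(1) by (simp add: conn_quotient_eq)
    qed
  next
    fix C assume C: "C \<in> insert (A \<union> B) (V // conn R - {A, B})"
    show "C \<in> V // conn (insert (a, b) R)"
    proof (cases "C = A \<union> B")
      case True
      then have "C = conn (insert (a, b) R) `` {a}" using cls[of a] AB by simp
      then show ?thesis using assms by (simp add: conn_quotient_eq)
    next
      case False
      then obtain x where x: "x \<in> V" "C = conn R `` {x}" "C \<noteq> A" "C \<noteq> B"
        using C unfolding conn_quotient_eq by auto
      then have "C = conn (insert (a, b) R) `` {x}" using class_if_mem[of x] cls[of x] by metis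
      then show ?thesis using x(1) by (simp add: conn_quotient_eq)
    qed
  qed
  \<comment> \<open>The merged class has to be new for the insertion to count; an old class
    containing \<open>a\<close> would be \<open>A\<close> itself.\<close>
  have "A \<union> B \<notin> V // conn R - {A, B}"
  proof
    assume "A \<union> B \<in> V // conn R - {A, B}"
    then obtain x where x: "A \<union> B = conn R `` {x}" "A \<union> B \<noteq> A"
      unfolding conn_quotient_eq by auto
    have "a \<in> conn R `` {x}" using AB(4) unfolding x(1)[symmetric] by simp
    then have "conn R `` {x} = A" using conn_class_eq_iff[of R x a] A_def by simp
    then show False using x by simp
  qed
  moreover have fin: "finite (V // conn R)" using assms by (simp add: conn_quotient_eq)
  ultimately have "card (V // conn (insert (a, b) R)) = Suc (card (V // conn R - {A, B}))"
    unfolding eq by simp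
  also have "card (V // conn R - {A, B}) = card (V // conn R) - 2"
    using AB fin by (simp add: card_Diff_subset)
  finally show ?thesis
    using False AB fin card_mono[OF fin, of "{A, B}"] by (simp add: ncomp_def)
qed

text \<open>Diminishing returns. An edge that does not lower the count over \<open>V\<close> has
  connected ends, hence connected images, and does not lower the count over \<open>W\<close> either.
  The map \<open>f\<close> serves to embed a partition as one layer of a three-row diagram.\<close>

lemma ncomp_submodular:
  assumes "finite V" "finite W" "finite X" "X \<subseteq> V \<times> V" "f ` V \<subseteq> W"
    and edge: "\<And>x y. (x, y) \<in> R \<Longrightarrow> (f x, f y) \<in> conn S"
  shows "ncomp W S + ncomp V (R \<union> X) \<le> ncomp V R + ncomp W (S \<union> map_prod f f ` X)"
  using assms(3,4)
proof (induction X rule: finite_induct)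
  case (insert e X)
  obtain a b where e: "e = (a, b)" "a \<in> V" "b \<in> V" using insert by auto
  let ?X = "map_prod f f ` X"
  have "(f a, f b) \<in> conn (S \<union> ?X)" if "(a, b) \<in> conn (R \<union> X)"
  proof (rule conn_map[OF that])
    fix x y assume "(x, y) \<in> R \<union> X"
    then show "(f x, f y) \<in> conn (S \<union> ?X)"
    proof
      assume "(x, y) \<in> R"
      then show ?thesis using edge conn_mono[of S "S \<union> ?X"] by blast
    next
      assume "(x, y) \<in> X"
      then have "map_prod f f (x, y) \<in> ?X" by (rule imageI)
      then show ?thesis by (intro conn_edge) simp
    qed
  qed
  moreover have "ncomp V (R \<union> X) = ncomp V (R \<union> insert e X) + of_bool ((a, b) \<notin> conn (R \<union> X))"
    using ncomp_insert[OF assms(1) e(2,3), of "R \<union> X"] by (simp add: e)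
  moreover have "ncomp W (S \<union> ?X) =
      ncomp W (S \<union> map_prod f f ` insert e X) + of_bool ((f a, f b) \<notin> conn (S \<union> ?X))"
    using ncomp_insert[OF assms(2), of "f a" "f b" "S \<union> ?X"] e assms(5) by (simp add: image_subset_iff)
  ultimately show ?case using insert by (auto split: if_splits simp: of_bool_def)
qed simp

text \<open>A path of \<open>S \<union> X\<close> between points of \<open>V\<close> is cut at its visits to \<open>V\<close>.\<close>

lemma conn_transfer:
  assumes X: "X \<subseteq> V \<times> V" and ab: "a \<in> V" "b \<in> V"
    and S: "\<And>x y. x \<in> V \<Longrightarrow> y \<in> V \<Longrightarrow> (x, y) \<in> conn S \<Longrightarrow> (x, y) \<in> conn R"
    and "(a, b) \<in> conn (S \<union> X)"
  shows "(a, b) \<in> conn (R \<union> X)"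
proof -
  have sub: "conn R \<subseteq> conn (R \<union> X)" by (rule conn_mono) auto
  have "\<exists>v\<in>V. (a, v) \<in> conn (R \<union> X) \<and> (v, b) \<in> conn S"
    using assms(5)
  proof (induction rule: conn_induct)
    case refl
    show ?case using ab by (intro bexI[of _ a]) auto
  next
    case (step x y)
    then obtain v where v: "v \<in> V" "(a, v) \<in> conn (R \<union> X)" "(v, x) \<in> conn S" by blast
    show ?case
    proof (cases "(x, y) \<in> S \<or> (y, x) \<in> S")
      case True
      then have "(x, y) \<in> conn S" using conn_edge[of x y S] conn_sym[OF conn_edge[of y x S]] by auto
      with v(3) have "(v, y) \<in> conn S" by (rule conn_trans)
      then show ?thesis using v by blast
    next
      case False
      then have "(x, y) \<in> X \<or> (y, x) \<in> X" using step by blast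
      then have xy: "x \<in> V" "y \<in> V" "(x, y) \<in> conn (R \<union> X)"
        using X conn_edge[of x y "R \<union> X"] conn_sym[OF conn_edge[of y x "R \<union> X"]] by auto
      then have "(a, y) \<in> conn (R \<union> X)"
        using conn_trans[OF conn_trans[OF v(2) subsetD[OF sub S[OF v(1) _ v(3)]]]] by blast
      then show ?thesis using \<open>y \<in> V\<close> by auto
    qed
  qed
  then obtain v where "v \<in> V" "(a, v) \<in> conn (R \<union> X)" "(v, b) \<in> conn S" by blast
  then show ?thesis using S[of v b] ab sub conn_trans[of a v "R \<union> X" b] by blast
qed

text \<open>Agreement of the two relations on \<open>V\<close> persists when edges inside
  \<open>V\<close> are added, so each new edge lowers both counts or neither. It serves to replace a
  stacked diagram by the composition that it induces on the outer rows.\<close>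

lemma ncomp_transfer:
  assumes "finite V" "V \<subseteq> W" "finite W" "finite X" "X \<subseteq> V \<times> V"
    and SR: "\<And>x y. x \<in> V \<Longrightarrow> y \<in> V \<Longrightarrow> (x, y) \<in> conn S \<longleftrightarrow> (x, y) \<in> conn R"
  shows "ncomp W (S \<union> X) + ncomp V R = ncomp W S + ncomp V (R \<union> X)"
  using assms(4,5)
proof (induction X rule: finite_induct)
  case (insert e X)
  obtain a b where e: "e = (a, b)" "a \<in> V" "b \<in> V" using insert by auto
  have "(a, b) \<in> conn (S \<union> X) \<longleftrightarrow> (a, b) \<in> conn (R \<union> X)"
    using conn_transfer[of X V a b S R] conn_transfer[of X V a b R S] e insert.prems SR by auto
  moreover have "ncomp V (R \<union> X) = ncomp V (R \<union> insert e X) + of_bool ((a, b) \<notin> conn (R \<union> X))"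
    using ncomp_insert[OF assms(1) e(2,3), of "R \<union> X"] by (simp add: e)
  moreover have "ncomp W (S \<union> X) = ncomp W (S \<union> insert e X) + of_bool ((a, b) \<notin> conn (S \<union> X))"
    using ncomp_insert[OF assms(3) subsetD[OF assms(2) e(2)] subsetD[OF assms(2) e(3)], of "S \<union> X"]
    by (simp add: e)
  ultimately show ?case using insert by auto
qed simp

lemma conn_subset:
  assumes "R \<subseteq> conn S"
  shows "conn R \<subseteq> conn S"
proof (rule subrelI)
  fix x y assume "(x, y) \<in> conn R"
  then show "(x, y) \<in> conn S"
    using conn_map[of x y R "\<lambda>x. x" S] assms by blast
qed

lemma ncomp_antimono:
  assumes "finite V" "\<And>x y. (x, y) \<in> R \<Longrightarrow> (x, y) \<in> conn S"
  shows "ncomp V S \<le> ncomp V R"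
proof (rule ncomp_le[where f = "\<lambda>x. x"])
  show "\<exists>v\<in>V. (v, w) \<in> conn S" if "w \<in> V" for w
    using that by (intro bexI[of _ w]) simp_all
qed (use assms in auto)

text \<open>A single edge of \<open>X\<close> between distinct classes would by itself lower the
  count. This is the equality case behind the separation of points by \<open>pdist\<close>.\<close>

lemma subset_conn_if_ncomp_eq:
  assumes "finite V" "X \<subseteq> V \<times> V" "ncomp V (R \<union> X) = ncomp V R"
  shows "X \<subseteq> conn R"
proof
  fix e assume "e \<in> X"
  then obtain a b where e: "e = (a, b)" "a \<in> V" "b \<in> V" "(a, b) \<in> X" using assms(2) by auto
  have "ncomp V (R \<union> X) \<le> ncomp V (insert (a, b) R)"
    using e(4) by (intro ncomp_antimono assms conn_edge) auto
  then show "e \<in> conn R"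
    using ncomp_insert[OF assms(1) e(2,3), of R] assms(3) e(1) by (simp split: if_splits add: of_bool_def)
qed

section \<open>Partitions as relations\<close>

definition block_rel :: "'a set set \<Rightarrow> ('a \<times> 'a) set" where
  "block_rel p = (\<Union>B\<in>p. B \<times> B)"

lemma block_rel_iff: "(x, y) \<in> block_rel p \<longleftrightarrow> (\<exists>B\<in>p. x \<in> B \<and> y \<in> B)"
  by (auto simp: block_rel_def)

lemma block_rel_subset: "partition_on V p \<Longrightarrow> block_rel p \<subseteq> V \<times> V"
  by (auto simp: block_rel_def partition_on_def)

lemma conn_block_rel_class:
  assumes "partition_on V p" "B \<in> p" "x \<in> B"
  shows "conn (block_rel p) `` {x} = B"
proof (intro equalityI subsetI)
  fix y assume "y \<in> conn (block_rel p) `` {x}"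
  then have "(x, y) \<in> conn (block_rel p)" by simp
  then show "y \<in> B"
  proof (induction rule: conn_induct)
    case (step y z)
    then obtain B' where "B' \<in> p" "y \<in> B'" "z \<in> B'" by (auto simp: block_rel_iff)
    then show ?case using step.IH assms(1,2) by (metis disjointD IntI emptyE partition_onD2)
  qed fact
qed (use assms in \<open>auto intro!: conn_edge simp: block_rel_iff\<close>)

lemma quotient_conn_block_rel:
  assumes "partition_on V p"
  shows "V // conn (block_rel p) = p"
proof (intro equalityI subsetI)
  fix C assume "C \<in> V // conn (block_rel p)"
  then obtain x where x: "x \<in> V" "C = conn (block_rel p) `` {x}" by (auto simp: conn_quotient_eq)
  then obtain B where "B \<in> p" "x \<in> B" using assms by (auto simp: partition_on_def)
  then show "C \<in> p" using conn_block_rel_class[OF assms] x by simp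
next
  fix B assume B: "B \<in> p"
  then obtain x where x: "x \<in> B" using partition_onD3[OF assms] by (metis all_not_in_conv)
  then have "x \<in> V" using assms B by (auto simp: partition_on_def)
  then show "B \<in> V // conn (block_rel p)"
    using conn_block_rel_class[OF assms B x] unfolding conn_quotient_eq by blast
qed

lemma partition_on_quotient_conn:
  assumes "R \<subseteq> V \<times> V"
  shows "partition_on V (V // conn R)"
proof -
  have sub: "conn R `` {x} \<subseteq> V" if "x \<in> V" for x
  proof
    fix y assume "y \<in> conn R `` {x}"
    then have "(x, y) \<in> conn R" by simp
    then show "y \<in> V" by (induction rule: conn_induct) (use that assms in auto)
  qed
  show ?thesis
  proof (rule partition_onI)
    show "\<Union> (V // conn R) = V"
    proof (intro equalityI subsetI)
      fix x assume "x \<in> V"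
      then show "x \<in> \<Union> (V // conn R)" unfolding conn_quotient_eq by (intro UnionI[of "conn R `` {x}"]) simp_all
    qed (use sub in \<open>auto simp: conn_quotient_eq\<close>)
    show "disjnt C D" if CD: "C \<in> V // conn R" "D \<in> V // conn R" "C \<noteq> D" for C D
    proof -
      obtain x y where xy: "C = conn R `` {x}" "D = conn R `` {y}"
        using CD(1,2) by (auto simp: conn_quotient_eq)
      show ?thesis
      proof (rule ccontr)
        assume "\<not> disjnt C D"
        then obtain z where "(x, z) \<in> conn R" "(y, z) \<in> conn R" by (auto simp: disjnt_iff xy)
        then have "(x, y) \<in> conn R" by (rule conn_trans[OF _ conn_sym])
        then show False using CD(3) xy conn_class_eq_iff by metis
      qed
    qed
    show "{} \<notin> V // conn R"
    proof
      assume "{} \<in> V // conn R"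
      then obtain x where x: "conn R `` {x} = {}" by (auto simp: conn_quotient_eq)
      have "x \<in> conn R `` {x}" by simp
      then show False unfolding x by simp
    qed
  qed
qed

section \<open>Joins and the distance between partitions\<close>

lemma finite_vertices [simp]: "finite (vertices k)"
  by (simp add: vertices_def)

lemma finite_Parts [simp]: "finite (Parts k)"
  unfolding Parts_def by (rule finitely_many_partition_on) simp

lemma Parts_partition: "p \<in> Parts k \<Longrightarrow> partition_on (vertices k) p"
  by (simp add: Parts_def)

lemma block_rel_Parts: "p \<in> Parts k \<Longrightarrow> block_rel p \<subseteq> vertices k \<times> vertices k"
  by (rule block_rel_subset) (rule Parts_partition)

lemma finite_block_rel: "p \<in> Parts k \<Longrightarrow> finite (block_rel p)"
  by (rule finite_subset[OF block_rel_Parts]) (simp_all add: finite_cartesian_product)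

lemma nc_eq_ncomp: "p \<in> Parts k \<Longrightarrow> nc p = ncomp (vertices k) (block_rel p)"
  by (simp add: nc_def ncomp_def quotient_conn_block_rel[OF Parts_partition])

text \<open>The block relation of an upper bound \<open>s\<close> contains those of \<open>p\<close>
  and \<open>q\<close>, hence \<open>s\<close> also joins everything that they connect. The join,
  given by description, thereby becomes a component count.\<close>

lemma is_join_quotient:
  assumes "p \<in> Parts k" "q \<in> Parts k"
  shows "is_join k p q (vertices k // conn (block_rel p \<union> block_rel q))"
proof -
  let ?V = "vertices k" and ?R = "block_rel p \<union> block_rel q"
  have part: "partition_on ?V (?V // conn ?R)"
    using block_rel_Parts assms by (intro partition_on_quotient_conn) blast
  have "refines ?V t (?V // conn ?R)" if t: "t \<in> Parts k" "block_rel t \<subseteq> ?R" for t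
    unfolding refines_def
  proof (intro conjI ballI part Parts_partition t)
    fix B assume B: "B \<in> t"
    then obtain x where x: "x \<in> B" "x \<in> ?V"
      using Parts_partition[OF t(1)] by (metis UnionI all_not_in_conv partition_onD1 partition_onD3)
    have "B \<subseteq> conn ?R `` {x}"
      using t(2) B x by (auto intro!: conn_edge simp: block_rel_def)
    then show "\<exists>C\<in>?V // conn ?R. B \<subseteq> C" using x by (auto simp: conn_quotient_eq)
  qed
  moreover have "refines ?V (?V // conn ?R) s" if s: "refines ?V p s" "refines ?V q s" for s
    unfolding refines_def
  proof (intro conjI ballI part)
    show ps: "partition_on ?V s" using s by (simp add: refines_def)
    fix C assume "C \<in> ?V // conn ?R"
    then obtain x where x: "x \<in> ?V" "C = conn ?R `` {x}" by (auto simp: conn_quotient_eq)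
    then obtain S where S: "S \<in> s" "x \<in> S" using ps by (auto simp: partition_on_def)
    have "block_rel t \<subseteq> block_rel s" if t: "refines ?V t s" for t
    proof (rule subrelI)
      fix y z assume "(y, z) \<in> block_rel t"
      then obtain B where B: "B \<in> t" "y \<in> B" "z \<in> B" by (auto simp: block_rel_iff)
      then obtain D where "D \<in> s" "B \<subseteq> D" using t unfolding refines_def by meson
      then show "(y, z) \<in> block_rel s" using B by (auto simp: block_rel_iff)
    qed
    then have "?R \<subseteq> block_rel s" using s by simp
    from conn_mono[OF this] have "C \<subseteq> conn (block_rel s) `` {x}" unfolding x(2) by (rule Image_mono) simp
    then show "\<exists>S\<in>s. C \<subseteq> S" using conn_block_rel_class[OF ps S] S by auto
  qed
  ultimately show ?thesis using assms by (auto simp: is_join_def)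
qed

lemma nc_join:
  assumes "p \<in> Parts k" "q \<in> Parts k"
  shows "nc (join k p q) = ncomp (vertices k) (block_rel p \<union> block_rel q)"
proof -
  have "join k p q = vertices k // conn (block_rel p \<union> block_rel q)"
    unfolding join_def
    by (rule the1_equality[OF ex1_join[OF assms] is_join_quotient[OF assms]])
  then show ?thesis by (simp add: nc_def ncomp_def)
qed

lemma nc_join_commute: "p \<in> Parts k \<Longrightarrow> q \<in> Parts k \<Longrightarrow> nc (join k p q) = nc (join k q p)"
  by (simp add: nc_join Un_commute)

text \<open>This is the triangle inequality for \<open>pdist\<close>, cleared of its halves. The
  edges of \<open>r\<close> remove at most as many components from the join of \<open>p\<close> and
  \<open>q\<close> as from \<open>q\<close>; dropping the edges of \<open>q\<close> afterwards can
  only increase the count.\<close>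

lemma nc_join_submodular:
  assumes "p \<in> Parts k" "q \<in> Parts k" "r \<in> Parts k"
  shows "nc (join k p q) + nc (join k q r) \<le> nc q + nc (join k p r)"
proof -
  let ?V = "vertices k"
  let ?S = "block_rel p \<union> block_rel q"
  have "ncomp ?V ?S + ncomp ?V (block_rel q \<union> block_rel r)
    \<le> ncomp ?V (block_rel q) + ncomp ?V (?S \<union> map_prod (\<lambda>x. x) (\<lambda>x. x) ` block_rel r)"
    using assms block_rel_Parts finite_block_rel
    by (intro ncomp_submodular) (auto intro!: conn_edge)
  also have "map_prod (\<lambda>x. x) (\<lambda>x. x) ` block_rel r = block_rel r" by (force simp: map_prod_def)
  also have "ncomp ?V (?S \<union> block_rel r) \<le> ncomp ?V (block_rel p \<union> block_rel r)"
    by (intro ncomp_antimono conn_edge) auto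
  finally show ?thesis using assms by (simp add: nc_join nc_eq_ncomp)
qed

lemma nc_join_le: "p \<in> Parts k \<Longrightarrow> q \<in> Parts k \<Longrightarrow> nc (join k p q) \<le> nc p"
  by (simp add: nc_join nc_eq_ncomp) (intro ncomp_antimono conn_edge, auto)

text \<open>Neither partition adds a connection to the other, so both generate the same equivalence
  relation. This is the separation property of \<open>pdist\<close>.\<close>

lemma eq_if_nc_join_eq:
  assumes "p \<in> Parts k" "q \<in> Parts k" "nc (join k p q) = nc p" "nc (join k p q) = nc q"
  shows "p = q"
proof -
  have "block_rel q \<subseteq> conn (block_rel p)"
    using assms by (intro subset_conn_if_ncomp_eq[of "vertices k"] block_rel_Parts) (simp_all add: nc_join nc_eq_ncomp)
  moreover have "block_rel p \<subseteq> conn (block_rel q)"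
    using assms by (intro subset_conn_if_ncomp_eq[of "vertices k"] block_rel_Parts)
      (simp_all add: nc_join nc_eq_ncomp Un_commute[of "block_rel q"])
  ultimately have "conn (block_rel p) = conn (block_rel q)"
    by (intro equalityI conn_subset)
  then show ?thesis using quotient_conn_block_rel[OF Parts_partition] assms by metis
qed

section \<open>Diagrams on three rows\<close>

definition rows :: "nat \<Rightarrow> vertex set" where
  "rows k = {Top, Mid, Bot} \<times> {1..k}"

text \<open>The diagram of \<open>p \<circ> q\<close>, closed by placing \<open>r\<close> on its outer rows.\<close>

definition tri :: "nat \<Rightarrow> diag \<Rightarrow> diag \<Rightarrow> diag \<Rightarrow> nat" where
  "tri k p q r = ncomp (rows k) (stacked_edges p q \<union> block_rel r)"

lemma finite_rows [simp]: "finite (rows k)"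
  by (simp add: rows_def)

lemma vertices_subset_rows: "vertices k \<subseteq> rows k"
  by (auto simp: vertices_def rows_def)

lemma place_in_rows:
  "v \<in> vertices k \<Longrightarrow> place_above v \<in> rows k" "v \<in> vertices k \<Longrightarrow> place_below v \<in> rows k"
  by (auto simp: vertices_def rows_def place_above_def place_below_def)

lemma stacked_edges_cases:
  assumes "(x, y) \<in> stacked_edges p q"
  obtains (above) u v where "(u, v) \<in> block_rel q" "x = place_above u" "y = place_above v"
  | (below) u v where "(u, v) \<in> block_rel p" "x = place_below u" "y = place_below v"
proof -
  from assms consider B where "B \<in> q" "x \<in> place_above ` B" "y \<in> place_above ` B"
    | B where "B \<in> p" "x \<in> place_below ` B" "y \<in> place_below ` B"
    unfolding stacked_edges_def by auto
  then show thesis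
  proof cases
    case 1
    then obtain u v where "u \<in> B" "v \<in> B" "x = place_above u" "y = place_above v" by (elim imageE)
    then show thesis using above[of u v] \<open>B \<in> q\<close> by (auto simp: block_rel_iff)
  next
    case 2
    then obtain u v where "u \<in> B" "v \<in> B" "x = place_below u" "y = place_below v" by (elim imageE)
    then show thesis using below[of u v] \<open>B \<in> p\<close> by (auto simp: block_rel_iff)
  qed
qed

lemma stacked_edges_above: "(u, v) \<in> block_rel q \<Longrightarrow> (place_above u, place_above v) \<in> stacked_edges p q"
  by (auto simp: stacked_edges_def block_rel_def)

lemma stacked_edges_below: "(u, v) \<in> block_rel p \<Longrightarrow> (place_below u, place_below v) \<in> stacked_edges p q"
  by (auto simp: stacked_edges_def block_rel_def)

lemma stacked_edges_subset:
  assumes "p \<in> Parts k" "q \<in> Parts k"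
  shows "stacked_edges p q \<subseteq> rows k \<times> rows k"
proof (rule subrelI)
  fix x y assume "(x, y) \<in> stacked_edges p q"
  then show "(x, y) \<in> rows k \<times> rows k"
    using block_rel_Parts[OF assms(1)] block_rel_Parts[OF assms(2)] place_in_rows[of _ k]
    by (cases rule: stacked_edges_cases) auto
qed

text \<open>The edges of a stack come from full squares and are symmetric already, so the closure
  used in the definition is \<open>conn\<close>.\<close>

lemma stack_components_eq: "stack_components k p q = rows k // conn (stacked_edges p q)"
proof -
  have "(stacked_edges p q)\<inverse> = stacked_edges p q"
    unfolding stacked_edges_def by auto
  then show ?thesis by (simp add: stack_components_def rows_def conn_def)
qed

lemma partition_on_stack_components:
  "p \<in> Parts k \<Longrightarrow> q \<in> Parts k \<Longrightarrow> partition_on (rows k) (stack_components k p q)"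
  unfolding stack_components_eq by (intro partition_on_quotient_conn stacked_edges_subset)

lemma pcomp_Parts:
  assumes "p \<in> Parts k" "q \<in> Parts k"
  shows "pcomp k p q \<in> Parts k"
proof -
  have "pcomp k p q = (\<inter>) (vertices k) ` stack_components k p q - {{}}"
    by (simp add: pcomp_def Int_commute)
  moreover have "vertices k \<inter> rows k = vertices k" using vertices_subset_rows by blast
  ultimately show ?thesis
    using partition_on_restrict[OF partition_on_stack_components[OF assms], of "vertices k"]
    by (simp add: Parts_def)
qed

lemma conn_pcomp_iff:
  assumes "p \<in> Parts k" "q \<in> Parts k" "x \<in> vertices k" "y \<in> vertices k"
  shows "(x, y) \<in> conn (block_rel (pcomp k p q)) \<longleftrightarrow> (x, y) \<in> conn (stacked_edges p q)"
proof -
  let ?C = "conn (stacked_edges p q) `` {x}"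
  have x: "x \<in> ?C \<inter> vertices k" using assms(3) by simp
  have "?C \<in> stack_components k p q"
    unfolding stack_components_eq conn_quotient_eq
    by (intro imageI subsetD[OF vertices_subset_rows] assms)
  then have "?C \<inter> vertices k \<in> pcomp k p q"
    unfolding pcomp_def
  proof (intro DiffI imageI)
    show "?C \<inter> vertices k \<notin> {{}}" using x by (metis emptyE singletonD)
  qed
  from conn_block_rel_class[OF Parts_partition[OF pcomp_Parts[OF assms(1,2)]] this x]
  have "y \<in> conn (block_rel (pcomp k p q)) `` {x} \<longleftrightarrow> y \<in> ?C \<inter> vertices k" by simp
  then show ?thesis using assms(4) by simp
qed

text \<open>A component lies in the middle row and is a loop, or it meets the outer rows and leaves
  a block there. Disjoint components leave distinct blocks.\<close>

lemma ncomp_stacked_edges: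
  assumes "p \<in> Parts k" "q \<in> Parts k"
  shows "ncomp (rows k) (stacked_edges p q) = loops k p q + nc (pcomp k p q)"
proof -
  let ?S = "stack_components k p q" and ?V = "vertices k"
  let ?A = "{C \<in> ?S. C \<subseteq> {Mid} \<times> {1..k}}" and ?B = "{C \<in> ?S. C \<inter> ?V \<noteq> {}}"
  have part: "partition_on (rows k) ?S" using assms by (rule partition_on_stack_components)
  have fin: "finite ?S" using finite_elements[OF finite_rows part] .
  have cover: "C \<subseteq> rows k" if "C \<in> ?S" for C using that part by (auto simp: partition_on_def)
  have "C \<subseteq> {Mid} \<times> {1..k} \<longleftrightarrow> C \<inter> ?V = {}" if "C \<in> ?S" for C
    using cover[OF that] by (auto simp: vertices_def rows_def)
  then have "?S = ?A \<union> ?B" "?A \<inter> ?B = {}" by auto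
  then have "card ?S = card ?A + card ?B"
    using card_Un_disjoint[of ?A ?B] fin by simp
  moreover have "pcomp k p q = (\<lambda>C. C \<inter> ?V) ` ?B" unfolding pcomp_def by auto
  moreover have "inj_on (\<lambda>C. C \<inter> ?V) ?B"
  proof (rule inj_onI)
    fix C D assume CD: "C \<in> ?B" "D \<in> ?B" "C \<inter> ?V = D \<inter> ?V"
    then obtain x where "x \<in> C" "x \<in> D" by blast
    then show "C = D" using disjointD[OF partition_onD2[OF part], of C D] CD(1,2) by auto
  qed
  ultimately show ?thesis
    by (simp add: ncomp_def stack_components_eq[symmetric] loops_def nc_def card_image)
qed

text \<open>\<open>r\<close> lives on the outer rows, where the stack and the composition connect
  the same points. Closing by \<open>r\<close> therefore lowers both counts equally and leaves the
  loops untouched.\<close>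

lemma tri_eq:
  assumes "p \<in> Parts k" "q \<in> Parts k" "r \<in> Parts k"
  shows "tri k p q r = loops k p q + nc (join k (pcomp k p q) r)"
proof -
  have "ncomp (rows k) (stacked_edges p q \<union> block_rel r) + ncomp (vertices k) (block_rel (pcomp k p q))
    = ncomp (rows k) (stacked_edges p q) + ncomp (vertices k) (block_rel (pcomp k p q) \<union> block_rel r)"
    using assms conn_pcomp_iff[OF assms(1,2)]
    by (intro ncomp_transfer finite_vertices finite_rows vertices_subset_rows finite_block_rel
        block_rel_Parts) simp_all
  then show ?thesis
    using assms nc_eq_ncomp[OF pcomp_Parts[OF assms(1,2)]]
    by (simp add: tri_def ncomp_stacked_edges nc_join pcomp_Parts)
qed

section \<open>Transposition and the symmetries of closed diagrams\<close>

lemma flip_flip [simp]: "flip (flip v) = v"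
  by (cases v rule: flip.cases) simp_all

lemma flip_in_vertices [simp]: "flip v \<in> vertices k \<longleftrightarrow> v \<in> vertices k"
  by (cases v rule: flip.cases) (auto simp: vertices_def)

lemma flip_in_rows [simp]: "flip v \<in> rows k \<longleftrightarrow> v \<in> rows k"
  by (cases v rule: flip.cases) (auto simp: rows_def)

lemma flip_place [simp]:
  assumes "v \<in> vertices k"
  shows "flip (place_above v) = place_below (flip v)" "flip (place_below v) = place_above (flip v)"
  using assms by (auto simp: vertices_def place_above_def place_below_def)

lemma ptranspose_ptranspose [simp]: "ptranspose (ptranspose p) = p"
  by (simp add: ptranspose_def image_image)

lemma ptranspose_Parts [simp]: "ptranspose p \<in> Parts k \<longleftrightarrow> p \<in> Parts k"
proof -
  have "ptranspose p \<in> Parts k" if "p \<in> Parts k" for p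
  proof -
    have "inj_on flip (vertices k)" by (rule inj_on_inverseI[of _ flip]) simp
    from partition_on_inj_image[OF Parts_partition[OF that] this]
    have "partition_on (flip ` vertices k) (ptranspose p - {{}})" by (simp add: ptranspose_def)
    moreover have "{} \<notin> ptranspose p"
      using partition_onD3[OF Parts_partition[OF that]] by (auto simp: ptranspose_def)
    moreover have "flip ` vertices k = vertices k"
    proof (intro equalityI subsetI)
      fix v assume "v \<in> vertices k"
      then show "v \<in> flip ` vertices k" by (intro image_eqI[of _ _ "flip v"]) simp_all
    qed auto
    ultimately show ?thesis by (simp add: Parts_def)
  qed
  from this[of p] this[of "ptranspose p"] show ?thesis by auto
qed

lemma block_rel_ptranspose: "(flip x, flip y) \<in> block_rel (ptranspose p) \<longleftrightarrow> (x, y) \<in> block_rel p"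
proof -
  have "flip v \<in> flip ` B \<longleftrightarrow> v \<in> B" for v B
    by (rule inj_image_mem_iff) (rule inj_on_inverseI[of _ flip], simp)
  then show ?thesis by (auto simp: block_rel_iff ptranspose_def)
qed

lemma id_part_Parts [simp]: "id_part k \<in> Parts k"
proof -
  have "partition_on (vertices k) (id_part k)"
    by (rule partition_onI) (auto simp: id_part_def vertices_def disjnt_def)
  then show ?thesis by (simp add: Parts_def)
qed

lemma block_rel_id_part: "(x, y) \<in> block_rel (id_part k) \<longleftrightarrow>
  x \<in> vertices k \<and> y \<in> vertices k \<and> snd x = snd y"
  by (cases x; cases y) (auto simp: block_rel_iff id_part_def vertices_def)

lemma ptranspose_id_part [simp]: "ptranspose (id_part k) = id_part k"
  by (simp add: ptranspose_def id_part_def image_image insert_commute)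

lemma nc_id_part: "nc (id_part k) = k"
proof -
  have "inj_on (\<lambda>i. {(Top, i), (Bot, i)}) {1..k}" by (auto simp: inj_on_def doubleton_eq_iff)
  then show ?thesis by (simp add: nc_def id_part_def card_image)
qed

lemma nc_join_ptranspose:
  assumes "p \<in> Parts k" "q \<in> Parts k"
  shows "nc (join k (ptranspose p) (ptranspose q)) = nc (join k p q)"
proof -
  have le: "nc (join k (ptranspose p) (ptranspose q)) \<le> nc (join k p q)"
    if "p \<in> Parts k" "q \<in> Parts k" for p q
  proof -
    have "ncomp (vertices k) (block_rel (ptranspose p) \<union> block_rel (ptranspose q))
      \<le> ncomp (vertices k) (block_rel p \<union> block_rel q)"
    proof (rule ncomp_le[where f = flip])
      show "\<exists>v\<in>vertices k. (flip v, w) \<in> conn (block_rel (ptranspose p) \<union> block_rel (ptranspose q))"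
        if "w \<in> vertices k" for w
        using that by (intro bexI[of _ "flip w"]) simp_all
    qed (auto intro!: conn_edge simp: block_rel_ptranspose)
    then show ?thesis using that by (simp add: nc_join)
  qed
  from le[OF assms] le[of "ptranspose p" "ptranspose q"] assms show ?thesis by simp
qed

text \<open>Turning the picture upside down swaps the two layers and transposes all three
  partitions. One inequality suffices, since the operation is an involution.\<close>

lemma tri_reflect:
  assumes "p \<in> Parts k" "q \<in> Parts k" "r \<in> Parts k"
  shows "tri k (ptranspose q) (ptranspose p) (ptranspose r) = tri k p q r"
proof -
  have le: "tri k (ptranspose q) (ptranspose p) (ptranspose r) \<le> tri k p q r"
    if "p \<in> Parts k" "q \<in> Parts k" "r \<in> Parts k" for p q r
    unfolding tri_def
  proof (rule ncomp_le[where f = flip])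
    let ?S = "stacked_edges (ptranspose q) (ptranspose p) \<union> block_rel (ptranspose r)"
    show "\<exists>v\<in>rows k. (flip v, w) \<in> conn ?S" if "w \<in> rows k" for w
      using that by (intro bexI[of _ "flip w"]) simp_all
    fix x y assume "(x, y) \<in> stacked_edges p q \<union> block_rel r"
    then consider "(x, y) \<in> stacked_edges p q" | "(x, y) \<in> block_rel r" by blast
    then have "(flip x, flip y) \<in> ?S"
    proof cases
      case 1
      then show ?thesis
      proof (cases rule: stacked_edges_cases)
        case (above u v)
        then have "u \<in> vertices k" "v \<in> vertices k" using block_rel_Parts that(2) by blast+
        then show ?thesis using above by (auto intro!: stacked_edges_below simp: block_rel_ptranspose)
      next
        case (below u v)
        then have "u \<in> vertices k" "v \<in> vertices k" using block_rel_Parts that(1) by blast+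
        then show ?thesis using below by (auto intro!: stacked_edges_above simp: block_rel_ptranspose)
      qed
    qed (simp add: block_rel_ptranspose)
    then show "(flip x, flip y) \<in> conn ?S" by (rule conn_edge)
  qed simp
  from le[OF assms] le[of "ptranspose q" "ptranspose p" "ptranspose r"] assms show ?thesis by simp
qed

text \<open>Each of the three pairs of rows carries one partition, so the rows may be permuted
  cyclically. With \<open>Mid\<close> moved to the top, \<open>Bot\<close> to the middle and
  \<open>Top\<close> to the bottom, \<open>p\<close> becomes the upper layer, while \<open>r\<close>
  becomes the lower layer and \<open>q\<close> the closing partition, both upside down.\<close>

lemma tri_rotate:
  assumes "p \<in> Parts k" "q \<in> Parts k" "r \<in> Parts k"
  shows "tri k (ptranspose r) p (ptranspose q) = tri k p q r"
proof -
  define f :: "vertex \<Rightarrow> vertex"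
    where "f = (\<lambda>(l, i). (case l of Top \<Rightarrow> Bot | Mid \<Rightarrow> Top | Bot \<Rightarrow> Mid, i))"
  have f: "f (place_above v) = flip v" "f (place_below v) = place_above v"
    "f v = place_below (flip v)" if "v \<in> vertices k" for v
    using that by (auto simp: f_def vertices_def place_above_def place_below_def)
  have surj: "\<exists>v\<in>rows k. f v = w" if "w \<in> rows k" for w
  proof -
    have "f (f (f w)) = w" "f (f w) \<in> rows k"
      using that by (auto simp: f_def rows_def split: level.splits)
    then show ?thesis by blast
  qed
  have le: "tri k (ptranspose r) p (ptranspose q) \<le> tri k p q r"
    if "p \<in> Parts k" "q \<in> Parts k" "r \<in> Parts k" for p q r
    unfolding tri_def
  proof (rule ncomp_le[where f = f])
    let ?S = "stacked_edges (ptranspose r) p \<union> block_rel (ptranspose q)"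
    show "\<exists>v\<in>rows k. (f v, w) \<in> conn ?S" if w: "w \<in> rows k" for w
    proof -
      obtain v where "v \<in> rows k" "f v = w" using surj[OF w] by blast
      then show ?thesis by (intro bexI[of _ v]) simp_all
    qed
    fix x y assume "(x, y) \<in> stacked_edges p q \<union> block_rel r"
    then consider "(x, y) \<in> stacked_edges p q" | "(x, y) \<in> block_rel r" by blast
    then have "(f x, f y) \<in> ?S"
    proof cases
      case 1
      then show ?thesis
      proof (cases rule: stacked_edges_cases)
        case (above u v)
        then have "u \<in> vertices k" "v \<in> vertices k" using block_rel_Parts that(2) by blast+
        then show ?thesis using above by (simp add: f block_rel_ptranspose)
      next
        case (below u v)
        then have "u \<in> vertices k" "v \<in> vertices k" using block_rel_Parts that(1) by blast+
        then show ?thesis using below by (simp add: f stacked_edges_above)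
      qed
    next
      case 2
      then have "x \<in> vertices k" "y \<in> vertices k" using block_rel_Parts that(3) by blast+
      then show ?thesis using 2 by (simp add: f(3) stacked_edges_below block_rel_ptranspose)
    qed
    then show "(f x, f y) \<in> conn ?S" by (rule conn_edge)
  qed simp
  \<comment> \<open>Three rotations give back the original triple, so the inequalities around the
    cycle are equalities.\<close>
  from le[OF assms] le[of "ptranspose r" p "ptranspose q"] le[of q "ptranspose r" "ptranspose p"] assms
  show ?thesis by simp
qed

text \<open>An identity in the lower layer glues the middle row to the bottom row, so that
  \<open>p\<close> and \<open>q\<close> end up on the same two rows.\<close>

lemma tri_id_part:
  assumes "p \<in> Parts k" "q \<in> Parts k"
  shows "tri k (id_part k) p q = nc (join k p q)"
  unfolding tri_def nc_join[OF assms]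
proof (rule antisym)
  let ?S = "stacked_edges (id_part k) p \<union> block_rel q"
  have mid_bot: "((Mid, i), (Bot, i)) \<in> conn ?S" if "i \<in> {1..k}" for i
  proof -
    have "((Top, i), (Bot, i)) \<in> block_rel (id_part k)" using that by (simp add: block_rel_id_part vertices_def)
    from stacked_edges_below[OF this, of p] show ?thesis
      by (intro conn_edge) (simp add: place_below_def)
  qed
  have above: "(place_above v, v) \<in> conn ?S" if "v \<in> vertices k" for v
    using that mid_bot by (auto simp: vertices_def place_above_def)
  show "ncomp (rows k) ?S \<le> ncomp (vertices k) (block_rel p \<union> block_rel q)"
  proof (rule ncomp_le[where f = "\<lambda>x. x"])
    show "\<exists>v\<in>vertices k. (v, w) \<in> conn ?S" if w: "w \<in> rows k" for w
    proof (cases "w \<in> vertices k")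
      case True
      then show ?thesis by (intro bexI[of _ w]) simp_all
    next
      case False
      then obtain i where "w = (Mid, i)" "i \<in> {1..k}" using w
        by (auto simp: rows_def vertices_def)
      then show ?thesis using conn_sym[OF mid_bot] by (intro bexI[of _ "(Bot, i)"]) (auto simp: vertices_def)
    qed
    show "(x, y) \<in> conn ?S" if "(x, y) \<in> block_rel p \<union> block_rel q" for x y
    proof (cases "(x, y) \<in> block_rel q")
      case True
      then show ?thesis by (intro conn_edge) simp
    next
      case False
      then have xy: "(x, y) \<in> block_rel p" using that by simp
      then have "x \<in> vertices k" "y \<in> vertices k" using block_rel_Parts assms(1) by blast+
      moreover have "(place_above x, place_above y) \<in> conn ?S"
        using stacked_edges_above[OF xy] by (intro conn_edge) simp
      ultimately show ?thesis
        using conn_trans[OF conn_sym[OF above[of x]] conn_trans[OF _ above[of y]]] by blast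
    qed
  qed simp
  \<comment> \<open>Collapses \<open>Mid\<close> onto \<open>Bot\<close>; both ends of an edge of
    the identity layer then coincide.\<close>
  define f :: "vertex \<Rightarrow> vertex" where "f = (\<lambda>(l, i). (if l = Mid then Bot else l, i))"
  have f: "f (place_above v) = v" "f v = v" if "v \<in> vertices k" for v
    using that by (auto simp: f_def vertices_def place_above_def)
  have f_below: "f (place_below v) = (Bot, snd v)" if "v \<in> vertices k" for v
    using that by (auto simp: f_def vertices_def place_below_def)
  show "ncomp (vertices k) (block_rel p \<union> block_rel q) \<le> ncomp (rows k) ?S"
  proof (rule ncomp_le[where f = f])
    show "\<exists>v\<in>rows k. (f v, w) \<in> conn (block_rel p \<union> block_rel q)" if "w \<in> vertices k" for w
      using that vertices_subset_rows by (intro bexI[of _ w]) (auto simp: f)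
    fix x y assume "(x, y) \<in> ?S"
    then consider "(x, y) \<in> stacked_edges (id_part k) p" | "(x, y) \<in> block_rel q" by blast
    then show "(f x, f y) \<in> conn (block_rel p \<union> block_rel q)"
    proof cases
      case 1
      then show ?thesis
      proof (cases rule: stacked_edges_cases)
        case (above u v)
        then have "u \<in> vertices k" "v \<in> vertices k" using block_rel_Parts assms(1) by blast+
        then show ?thesis using above by (auto simp: f intro: conn_edge)
      next
        case (below u v)
        then show ?thesis by (simp add: block_rel_id_part f_below)
      qed
    next
      case 2
      then have "x \<in> vertices k" "y \<in> vertices k" using block_rel_Parts assms(2) by blast+
      then show ?thesis using 2 by (simp add: f conn_edge)
    qed
  qed simp
qed

text \<open>A rotation moves the closing identity into the layer under \<open>p\<close> and turns
  \<open>ptranspose q\<close> back into \<open>q\<close>. The left side is the exponent of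
  \<open>N\<close> in the trace of \<open>p\<close> times \<open>ptranspose q\<close>.\<close>

lemma loops_nc_join_id_part:
  assumes "p \<in> Parts k" "q \<in> Parts k"
  shows "loops k p (ptranspose q) + nc (join k (pcomp k p (ptranspose q)) (id_part k)) = nc (join k p q)"
  using tri_rotate[of p k "ptranspose q" "id_part k"] assms
  by (simp add: tri_eq[symmetric] tri_id_part)

lemma loops_nc_join_id_part':
  assumes "p \<in> Parts k" "q \<in> Parts k"
  shows "loops k (ptranspose p) q + nc (join k (pcomp k (ptranspose p) q) (id_part k)) = nc (join k p q)"
  using loops_nc_join_id_part[of "ptranspose p" k "ptranspose q"] assms
  by (simp add: nc_join_ptranspose)

text \<open>Every point of the three rows is joined to its two copies when both factors are closed by the
  identity, which is coarser than closing the composition by the identity.\<close>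

lemma nc_pcomp_le:
  assumes "p \<in> Parts k" "q \<in> Parts k"
  shows "loops k p q + nc (pcomp k p q) + nc (join k p (id_part k)) + nc (join k q (id_part k))
    \<le> nc p + nc q + nc (join k (pcomp k p q) (id_part k))"
proof -
  let ?V = "vertices k" and ?W = "rows k" and ?S = "stacked_edges p q" and ?I = "block_rel (id_part k)"
  let ?X = "map_prod place_above place_above ` ?I" and ?Y = "map_prod place_below place_below ` ?I"
  let ?T = "?S \<union> ?Y \<union> ?X"
  \<comment> \<open>\<open>place_below\<close> embeds \<open>p\<close> as the lower layer, so the
    vertical edges \<open>?Y\<close> remove at most as many components from the stack as the
    identity removes from \<open>p\<close> alone. The next inequality does the same for
    \<open>q\<close> and \<open>?X\<close>.\<close>
  have "ncomp ?W ?S + ncomp ?V (block_rel p \<union> ?I) \<le> ncomp ?V (block_rel p) + ncomp ?W (?S \<union> ?Y)"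
    by (rule ncomp_submodular)
      (auto simp: finite_block_rel[OF id_part_Parts] block_rel_id_part place_in_rows intro!: conn_edge stacked_edges_below)
  moreover have "ncomp ?W (?S \<union> ?Y) + ncomp ?V (block_rel q \<union> ?I) \<le> ncomp ?V (block_rel q) + ncomp ?W ?T"
    by (rule ncomp_submodular)
      (auto simp: finite_block_rel[OF id_part_Parts] block_rel_id_part place_in_rows intro!: conn_edge stacked_edges_above)
  moreover have "ncomp ?W ?T \<le> ncomp ?V (block_rel (pcomp k p q) \<union> ?I)"
  proof (rule ncomp_le[where f = "\<lambda>x. x"])
    have tm: "((Top, i), (Mid, i)) \<in> conn ?T" and mb: "((Mid, i), (Bot, i)) \<in> conn ?T" if "i \<in> {1..k}" for i
    proof -
      have e: "((Top, i), (Bot, i)) \<in> ?I" using that by (simp add: block_rel_id_part vertices_def)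
      show "((Top, i), (Mid, i)) \<in> conn ?T"
        using imageI[OF e, of "map_prod place_above place_above"]
        by (intro conn_edge) (simp add: place_above_def)
      show "((Mid, i), (Bot, i)) \<in> conn ?T"
        using imageI[OF e, of "map_prod place_below place_below"]
        by (intro conn_edge) (simp add: place_below_def)
    qed
    show "\<exists>v\<in>?V. (v, w) \<in> conn ?T" if w: "w \<in> ?W" for w
    proof (cases "w \<in> ?V")
      case True
      then show ?thesis by (intro bexI[of _ w]) simp_all
    next
      case False
      then obtain i where "w = (Mid, i)" "i \<in> {1..k}" using w
        by (auto simp: rows_def vertices_def)
      then show ?thesis using tm by (intro bexI[of _ "(Top, i)"]) (auto simp: vertices_def)
    qed
    show "(x, y) \<in> conn ?T" if "(x, y) \<in> block_rel (pcomp k p q) \<union> ?I" for x y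
    proof (cases "(x, y) \<in> ?I")
      case True
      then show ?thesis
        using conn_trans[OF tm mb] conn_sym[OF conn_trans[OF tm mb]]
        by (auto simp: block_rel_id_part vertices_def)
    next
      case False
      then have xy: "(x, y) \<in> block_rel (pcomp k p q)" using that by simp
      then have "x \<in> ?V" "y \<in> ?V" using block_rel_Parts pcomp_Parts[OF assms] by blast+
      then have "(x, y) \<in> conn ?S" using conn_pcomp_iff[OF assms] conn_edge[OF xy] by simp
      moreover have "conn ?S \<subseteq> conn ?T" by (rule conn_mono) auto
      ultimately show ?thesis by blast
    qed
  qed simp
  ultimately show ?thesis
    using assms by (simp add: nc_join pcomp_Parts ncomp_stacked_edges[symmetric] nc_eq_ncomp)
qed

section \<open>Moments and cumulants\<close>

lemma lin_form_basis: "p \<in> Parts k \<Longrightarrow> lin_form k f (basis p) = f p"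
  by (simp add: lin_form_def basis_def if_distrib[where f = "\<lambda>c. c * _"] sum.delta cong: if_cong)

lemma lin_form_cong: "(\<And>p. p \<in> Parts k \<Longrightarrow> f p = g p) \<Longrightarrow> lin_form k f = lin_form k g"
  by (simp add: lin_form_def)

lemma lin_form_pmult:
  "lin_form k f (pmult k N x y) =
     (\<Sum>p\<in>Parts k. \<Sum>q\<in>Parts k. x p * y q * (of_nat N ^ loops k p q * f (pcomp k p q)))"
proof -
  have "lin_form k f (pmult k N x y) = (\<Sum>r\<in>Parts k. \<Sum>p\<in>Parts k. \<Sum>q\<in>Parts k.
      x p * y q * (of_nat N ^ loops k p q * (basis (pcomp k p q) r * f r)))"
    unfolding lin_form_def pmult_def sum_distrib_right by (simp add: mult.assoc)
  also have "\<dots> = (\<Sum>p\<in>Parts k. \<Sum>q\<in>Parts k. \<Sum>r\<in>Parts k.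
      x p * y q * (of_nat N ^ loops k p q * (basis (pcomp k p q) r * f r)))"
    by (subst sum.swap) (rule sum.cong[OF refl], rule sum.swap)
  also have "\<dots> = (\<Sum>p\<in>Parts k. \<Sum>q\<in>Parts k.
      x p * y q * (of_nat N ^ loops k p q * lin_form k f (basis (pcomp k p q))))"
    unfolding lin_form_def sum_distrib_left ..
  also have "\<dots> = (\<Sum>p\<in>Parts k. \<Sum>q\<in>Parts k. x p * y q * (of_nat N ^ loops k p q * f (pcomp k p q)))"
    by (intro sum.cong refl) (simp add: lin_form_basis pcomp_Parts)
  finally show ?thesis .
qed

lemma Tr_pmult_ptranspose:
  assumes "p \<in> Parts k"
  shows "Tr k N (pmult k N x (basis (ptranspose p))) = (\<Sum>q\<in>Parts k. x q * of_nat N ^ nc (join k q p))"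
proof -
  have "Tr k N (pmult k N x (basis (ptranspose p))) = (\<Sum>q\<in>Parts k. x q *
     lin_form k (\<lambda>r. of_nat N ^ loops k q r * of_nat N ^ nc (join k (pcomp k q r) (id_part k)))
       (basis (ptranspose p)))"
    unfolding Tr_def lin_form_pmult unfolding lin_form_def sum_distrib_left by (simp add: mult.assoc)
  also have "\<dots> = (\<Sum>q\<in>Parts k. x q * of_nat N ^ nc (join k q p))"
    using assms by (intro sum.cong refl)
      (simp add: lin_form_basis power_add[symmetric] loops_nc_join_id_part)
  finally show ?thesis .
qed

lemma moment_eq:
  assumes "p \<in> Parts k"
  shows "moment k N p x =
    (\<Sum>q\<in>Parts k. x q * of_nat N ^ nc (join k q p)) / of_nat N ^ nc (join k p (id_part k))"
  unfolding moment_def Tr_pmult_ptranspose[OF assms] using assms by (simp add: Tr_def lin_form_basis)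

text \<open>The halves cancel in d(id,q) + d(q,p) - d(id,p), which leaves an integer usable as an
  exponent of \<open>powi\<close>.\<close>

definition defect :: "nat \<Rightarrow> diag \<Rightarrow> diag \<Rightarrow> int" where
  "defect k q p = int (nc q) + int (nc (join k p (id_part k)))
     - int (nc (join k q (id_part k))) - int (nc (join k q p))"

lemma defect_nonneg:
  assumes "p \<in> Parts k" "q \<in> Parts k"
  shows "0 \<le> defect k q p"
  using nc_join_submodular[of "id_part k" k q p] assms
  by (simp add: defect_def nc_join_commute[of _ k "id_part k"])

lemma defect_eq_pdist:
  assumes "p \<in> Parts k" "q \<in> Parts k"
  shows "real_of_int (defect k q p) = pdist k (id_part k) q + pdist k q p - pdist k (id_part k) p"
  using assms by (simp add: defect_def pdist_def nc_join_commute[of _ k "id_part k"] field_simps)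

lemma defect_eq_0_iff:
  assumes "p \<in> Parts k" "q \<in> Parts k"
  shows "defect k q p = 0 \<longleftrightarrow> geo_le k q p"
  using defect_eq_pdist[OF assms] unfolding geo_le_def by linarith

text \<open>The join has at most as many blocks as either partition, with equality in both cases
  only for equal partitions. Strictness is what makes d(id, p) strictly increase along
  \<open>geo_le\<close>.\<close>

lemma pdist_pos:
  assumes "p \<in> Parts k" "q \<in> Parts k" "p \<noteq> q"
  shows "0 < pdist k p q"
proof -
  have "nc (join k p q) \<le> nc p" "nc (join k p q) \<le> nc q"
    using nc_join_le assms nc_join_commute by metis+
  moreover have "nc (join k p q) \<noteq> nc p \<or> nc (join k p q) \<noteq> nc q"
    using eq_if_nc_join_eq assms by blast
  ultimately have "2 * nc (join k p q) < nc p + nc q" by linarith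
  then have "2 * real (nc (join k p q)) < real (nc p) + real (nc q)" by linarith
  then show ?thesis by (simp add: pdist_def)
qed

text \<open>The normalisations of the moment at \<open>p\<close> and of the cumulant at
  \<open>q\<close> combine with the power from the trace into the exponent
  \<open>- defect k q p\<close>. Cancelling powers of \<open>N\<close> is where \<open>N > 0\<close>
  enters.\<close>

lemma cumulant_weight:
  assumes "N > 0"
  shows "x q * of_nat N ^ nc (join k q p) / of_nat N ^ nc (join k p (id_part k)) =
    of_nat N powi (- defect k q p) * cumulant k N q x"
  using assms unfolding defect_def cumulant_def
  by (simp add: power_int_diff power_int_add power_int_minus field_simps)

lemma moment_cumulant:
  assumes "N > 0" "p \<in> Parts k"
  shows "moment k N p x = (\<Sum>q\<in>Parts k. of_nat N powi (- defect k q p) * cumulant k N q x)"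
  unfolding moment_eq[OF assms(2)] sum_divide_distrib using assms(1)
  by (simp add: cumulant_weight)

section \<open>Moments and cumulants of a product\<close>

lemma moment_pmult:
  assumes "p \<in> Parts k"
  shows "moment k N p (pmult k N x y) = (\<Sum>p1\<in>Parts k. \<Sum>p2\<in>Parts k.
    x p1 * y p2 * of_nat N ^ tri k p1 p2 p) / of_nat N ^ nc (join k p (id_part k))"
proof -
  have "(\<Sum>q\<in>Parts k. pmult k N x y q * of_nat N ^ nc (join k q p)) =
    (\<Sum>p1\<in>Parts k. \<Sum>p2\<in>Parts k. x p1 * y p2 * of_nat N ^ tri k p1 p2 p)"
    using lin_form_pmult[of k "\<lambda>q. of_nat N ^ nc (join k q p)" N x y] assms
    by (simp add: lin_form_def tri_eq power_add cong: sum.cong)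
  then show ?thesis using moment_eq[OF assms, of N "pmult k N x y"] by simp
qed

lemma power_times_moment:
  assumes "N > 0" "r \<in> Parts k"
  shows "of_nat N ^ nc (join k r (id_part k)) * moment k N r x =
    (\<Sum>q\<in>Parts k. x q * of_nat N ^ nc (join k r q))"
  using assms by (simp add: moment_eq nc_join_commute cong: sum.cong)

text \<open>For fixed \<open>p1\<close>, a rotation and a reflection bring \<open>p2\<close> into
  the closing position of \<open>tri k p1 p2 p\<close>, so the sum over \<open>p2\<close> is an
  unnormalised moment of \<open>y\<close> at \<open>?r\<close>. The loops and the normalisation of
  that moment add up to \<open>nc (join k p1 p)\<close>, the exponent that \<open>p1\<close> has in
  a moment at \<open>p\<close>.\<close>

lemma moment_pmult_left:
  assumes "N > 0" "p \<in> Parts k"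
  shows "moment k N p (pmult k N x y) = (\<Sum>p1\<in>Parts k.
    of_nat N powi (- defect k p1 p) * cumulant k N p1 x * moment k N (pcomp k (ptranspose p1) p) y)"
proof -
  have "(\<Sum>p2\<in>Parts k. x p1 * y p2 * of_nat N ^ tri k p1 p2 p) =
    x p1 * of_nat N ^ nc (join k p1 p) * moment k N (pcomp k (ptranspose p1) p) y"
    if p1: "p1 \<in> Parts k" for p1
  proof -
    let ?r = "pcomp k (ptranspose p1) p"
    have r: "?r \<in> Parts k" using p1 assms by (simp add: pcomp_Parts)
    have "tri k p1 p2 p = loops k (ptranspose p1) p + nc (join k ?r p2)" if "p2 \<in> Parts k" for p2
      using tri_reflect[of "ptranspose p" k p1 "ptranspose p2"] tri_rotate[of p1 k p2 p] p1 that assms(2)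
      by (simp add: tri_eq[symmetric])
    then have "(\<Sum>p2\<in>Parts k. x p1 * y p2 * of_nat N ^ tri k p1 p2 p) =
      x p1 * of_nat N ^ loops k (ptranspose p1) p * (\<Sum>p2\<in>Parts k. y p2 * of_nat N ^ nc (join k ?r p2))"
      by (simp add: power_add sum_distrib_left mult_ac cong: sum.cong)
    also have "\<dots> = x p1 * of_nat N ^ (loops k (ptranspose p1) p + nc (join k ?r (id_part k))) * moment k N ?r y"
      by (simp add: power_times_moment[OF assms(1) r, symmetric] power_add)
    finally show ?thesis using loops_nc_join_id_part'[OF p1 assms(2)] by simp
  qed
  then have "moment k N p (pmult k N x y) = (\<Sum>p1\<in>Parts k.
    x p1 * of_nat N ^ nc (join k p1 p) / of_nat N ^ nc (join k p (id_part k))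
      * moment k N (pcomp k (ptranspose p1) p) y)"
    unfolding moment_pmult[OF assms(2)] by (simp add: sum_divide_distrib)
  then show ?thesis unfolding cumulant_weight[OF assms(1)] .
qed

text \<open>Mirror image of the left formula: the partition of the second factor is fixed, and two
  rotations and a reflection bring that of the first into the closing position.\<close>

lemma moment_pmult_right:
  assumes "N > 0" "p \<in> Parts k"
  shows "moment k N p (pmult k N x y) = (\<Sum>p1\<in>Parts k.
    of_nat N powi (- defect k p1 p) * cumulant k N p1 y * moment k N (pcomp k p (ptranspose p1)) x)"
proof -
  have "(\<Sum>p2\<in>Parts k. x p2 * y p1 * of_nat N ^ tri k p2 p1 p) =
    y p1 * of_nat N ^ nc (join k p1 p) * moment k N (pcomp k p (ptranspose p1)) x"
    if p1: "p1 \<in> Parts k" for p1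
  proof -
    let ?r = "pcomp k p (ptranspose p1)"
    have r: "?r \<in> Parts k" using p1 assms by (simp add: pcomp_Parts)
    have "tri k p2 p1 p = loops k p (ptranspose p1) + nc (join k ?r p2)" if "p2 \<in> Parts k" for p2
      using tri_reflect[of p1 k "ptranspose p" "ptranspose p2"]
        tri_rotate[of "ptranspose p" k p2 "ptranspose p1"] tri_rotate[of p2 k p1 p] p1 that assms(2)
      by (simp add: tri_eq[symmetric])
    then have "(\<Sum>p2\<in>Parts k. x p2 * y p1 * of_nat N ^ tri k p2 p1 p) =
      y p1 * of_nat N ^ loops k p (ptranspose p1) * (\<Sum>p2\<in>Parts k. x p2 * of_nat N ^ nc (join k ?r p2))"
      by (simp add: power_add sum_distrib_left mult_ac cong: sum.cong)
    also have "\<dots> = y p1 * of_nat N ^ (loops k p (ptranspose p1) + nc (join k ?r (id_part k))) * moment k N ?r x"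
      by (simp add: power_times_moment[OF assms(1) r, symmetric] power_add)
    finally show ?thesis
      using loops_nc_join_id_part[OF assms(2) p1] nc_join_commute[OF p1 assms(2)] by simp
  qed
  then have "moment k N p (pmult k N x y) = (\<Sum>p1\<in>Parts k.
    y p1 * of_nat N ^ nc (join k p1 p) / of_nat N ^ nc (join k p (id_part k))
      * moment k N (pcomp k p (ptranspose p1)) x)"
    unfolding moment_pmult[OF assms(2)] by (subst sum.swap) (simp add: sum_divide_distrib)
  then show ?thesis unfolding cumulant_weight[OF assms(1)] .
qed

text \<open>Difference of the two sides of the distance condition in \<open>Kset\<close>, in which
  the halves cancel again.\<close>

definition comp_defect :: "nat \<Rightarrow> diag \<Rightarrow> diag \<Rightarrow> int" where
  "comp_defect k p q = int (nc p) + int (nc q) + int (nc (join k (pcomp k p q) (id_part k)))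
     - int (loops k p q) - int (nc (pcomp k p q))
     - int (nc (join k p (id_part k))) - int (nc (join k q (id_part k)))"

lemma comp_defect_nonneg: "p \<in> Parts k \<Longrightarrow> q \<in> Parts k \<Longrightarrow> 0 \<le> comp_defect k p q"
  using nc_pcomp_le[of p k q] by (simp add: comp_defect_def)

lemma comp_defect_eq_0_iff:
  assumes "p \<in> Parts k" "q \<in> Parts k"
  shows "comp_defect k p q = 0 \<longleftrightarrow> q \<in> Kset k (pcomp k p q) p"
proof -
  have "real_of_int (comp_defect k p q) =
    pdist k (id_part k) p + pdist k (id_part k) q
       - (real k + real (nc (pcomp k p q)) - real (nc p) - real (nc q)) / 2
       - real (loops k p q) - pdist k (id_part k) (pcomp k p q)"
    using assms by (simp add: comp_defect_def pdist_def nc_id_part pcomp_Parts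
        nc_join_commute[of _ k "id_part k"] field_simps)
  then show ?thesis using assms(2) by (auto simp: Kset_def)
qed

text \<open>Read off the coordinates, without traces: the loops and the three normalisations
  contribute powers of \<open>N\<close> whose exponents add up to
  \<open>- comp_defect k p1 p2\<close>.\<close>

lemma cumulant_pmult:
  assumes "N > 0"
  shows "cumulant k N p (pmult k N x y) = (\<Sum>p1\<in>Parts k. \<Sum>p2\<in>Parts k.
    of_bool (pcomp k p1 p2 = p) *
      (of_nat N powi (- comp_defect k p1 p2) * cumulant k N p1 x * cumulant k N p2 y))"
  unfolding cumulant_def[of k N p] pmult_def sum_distrib_left
proof (intro sum.cong refl)
  fix p1 p2
  show "of_nat N powi (int (nc p) - int (nc (join k p (id_part k)))) *
      (x p1 * y p2 * (of_nat N ^ loops k p1 p2 * basis (pcomp k p1 p2) p)) =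
    of_bool (pcomp k p1 p2 = p) *
      (of_nat N powi (- comp_defect k p1 p2) * cumulant k N p1 x * cumulant k N p2 y)"
    using assms
    by (auto simp: basis_def comp_defect_def cumulant_def power_int_diff power_int_add power_int_minus
        field_simps)
qed

section \<open>Limits\<close>

lemma powi_minus_tendsto:
  assumes "0 \<le> d"
  shows "(\<lambda>N. of_nat N powi (- d) :: complex) \<longlonglongrightarrow> of_bool (d = 0)"
proof (cases "d = 0")
  case False
  then obtain n where n: "d = int (Suc n)" using assms by (metis nonneg_int_cases not0_implies_Suc of_nat_0)
  have "(\<lambda>N. inverse (of_nat N) ^ Suc n :: complex) \<longlonglongrightarrow> 0 ^ Suc n"
    by (intro tendsto_power lim_inverse_n)
  moreover have "of_nat N powi (- d) = (inverse (of_nat N) ^ Suc n :: complex)" for N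
    unfolding n power_int_minus power_int_of_nat power_inverse ..
  ultimately show ?thesis using False by simp
qed simp

text \<open>The inner sum at \<open>r\<close> is \<open>x r\<close> plus the values
  \<open>x s\<close> with \<open>s\<close> strictly below \<open>r\<close>, and these have smaller
  \<open>h\<close>, so the system is solved recursively. The coefficients \<open>b\<close> form a
  row of the inverse matrix and are the same for every \<open>x\<close>.\<close>

lemma unitriangular_inverse:
  fixes h :: "'a \<Rightarrow> real"
  assumes "finite P"
    and refl: "\<And>p. p \<in> P \<Longrightarrow> le p p"
    and mono: "\<And>p q. p \<in> P \<Longrightarrow> q \<in> P \<Longrightarrow> le q p \<Longrightarrow> q \<noteq> p \<Longrightarrow> h q < h p"
    and "r \<in> P"
  shows "\<exists>b :: 'a \<Rightarrow> complex. \<forall>x. x r = (\<Sum>p\<in>P. b p * (\<Sum>q\<in>P. of_bool (le q p) * x q))"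
  using assms(4)
\<comment> \<open>\<open>h\<close> is real-valued; the recursion descends along the number of points
  of the finite set with smaller \<open>h\<close> instead.\<close>
proof (induction "card {q \<in> P. h q < h r}" arbitrary: r rule: less_induct)
  case less
  let ?Q = "{q \<in> P. le q r \<and> q \<noteq> r}"
  have "\<exists>b :: 'a \<Rightarrow> complex. \<forall>x. x s = (\<Sum>p\<in>P. b p * (\<Sum>q\<in>P. of_bool (le q p) * x q))" if "s \<in> ?Q" for s
  proof (rule less.hyps)
    have "h s < h r" using that less.prems assms(3) by blast
    then show "card {q \<in> P. h q < h s} < card {q \<in> P. h q < h r}"
      using that assms(1) by (intro psubset_card_mono) auto
  qed (use that in simp)
  then have "\<forall>s\<in>?Q. \<exists>b :: 'a \<Rightarrow> complex. \<forall>x. x s = (\<Sum>p\<in>P. b p * (\<Sum>q\<in>P. of_bool (le q p) * x q))"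
    by (rule ballI)
  from bchoice[OF this] obtain B :: "'a \<Rightarrow> 'a \<Rightarrow> complex"
    where "\<forall>s\<in>?Q. \<forall>x. x s = (\<Sum>p\<in>P. B s p * (\<Sum>q\<in>P. of_bool (le q p) * x q))" ..
  then have B: "x s = (\<Sum>p\<in>P. B s p * (\<Sum>q\<in>P. of_bool (le q p) * x q))" if "s \<in> ?Q" for s x
    using that by simp
  show ?case
  proof (intro exI[of _ "\<lambda>p. of_bool (p = r) - (\<Sum>s\<in>?Q. B s p)"] allI)
    fix x :: "'a \<Rightarrow> complex"
    define y where "y p = (\<Sum>q\<in>P. of_bool (le q p) * x q)" for p
    have "y r = (\<Sum>q\<in>{q \<in> P. le q r}. x q)"
      unfolding y_def using assms(1)
      by (simp add: of_bool_def if_distrib[where f = "\<lambda>c. c * _"] sum.inter_filter[symmetric] cong: if_cong)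
    also have "{q \<in> P. le q r} = insert r ?Q" using refl less.prems by auto
    also have "(\<Sum>q\<in>insert r ?Q. x q) = x r + (\<Sum>s\<in>?Q. x s)" using assms(1) by simp
    also have "(\<Sum>s\<in>?Q. x s) = (\<Sum>s\<in>?Q. \<Sum>p\<in>P. B s p * y p)"
      unfolding y_def by (rule sum.cong[OF HOL.refl]) (rule B)
    also have "\<dots> = (\<Sum>p\<in>P. (\<Sum>s\<in>?Q. B s p) * y p)"
      unfolding sum_distrib_right by (rule sum.swap)
    finally have "x r = y r - (\<Sum>p\<in>P. (\<Sum>s\<in>?Q. B s p) * y p)" by simp
    also have "y r = (\<Sum>p\<in>P. of_bool (p = r) * y p)"
      using assms(1) less.prems by (simp add: of_bool_def if_distrib[where f = "\<lambda>c. c * _"] cong: if_cong)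
    finally show "x r = (\<Sum>p\<in>P. (of_bool (p = r) - (\<Sum>s\<in>?Q. B s p)) * (\<Sum>q\<in>P. of_bool (le q p) * x q))"
      unfolding y_def[symmetric] by (simp add: left_diff_distrib sum_subtractf)
  qed
qed

text \<open>The solution is first bounded, by absorbing the error of the matrix; the error is then negligible.\<close>

lemma convergent_solution:
  fixes a :: "nat \<Rightarrow> 'a \<Rightarrow> 'a \<Rightarrow> complex" and h :: "'a \<Rightarrow> real"
  assumes "finite P"
    and refl: "\<And>p. p \<in> P \<Longrightarrow> le p p"
    and mono: "\<And>p q. p \<in> P \<Longrightarrow> q \<in> P \<Longrightarrow> le q p \<Longrightarrow> q \<noteq> p \<Longrightarrow> h q < h p"
    and a: "\<And>p q. p \<in> P \<Longrightarrow> q \<in> P \<Longrightarrow> (\<lambda>N. a N p q) \<longlonglongrightarrow> of_bool (le q p)"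
    and y: "\<forall>\<^sub>F N in sequentially. \<forall>p\<in>P. y N p = (\<Sum>q\<in>P. a N p q * x N q)"
    and conv: "\<And>p. p \<in> P \<Longrightarrow> convergent (\<lambda>N. y N p)"
    and "r \<in> P"
  shows "convergent (\<lambda>N. x N r)"
proof -
  have "\<forall>r\<in>P. \<exists>b :: 'a \<Rightarrow> complex. \<forall>x. x r = (\<Sum>p\<in>P. b p * (\<Sum>q\<in>P. of_bool (le q p) * x q))"
    by (intro ballI unitriangular_inverse[where le = le and h = h, OF assms(1) refl mono])
  from bchoice[OF this] obtain b :: "'a \<Rightarrow> 'a \<Rightarrow> complex"
    where "\<forall>r\<in>P. \<forall>x. x r = (\<Sum>p\<in>P. b r p * (\<Sum>q\<in>P. of_bool (le q p) * x q))" ..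
  then have b: "x r = (\<Sum>p\<in>P. b r p * (\<Sum>q\<in>P. of_bool (le q p) * x q))" if "r \<in> P" for r x
    using that by simp
  define e where "e N p q = a N p q - of_bool (le q p)" for N p q
  define s where "s N = (\<Sum>r\<in>P. norm (x N r))" for N
  define Y where "Y N = (\<Sum>r\<in>P. \<Sum>p\<in>P. norm (b r p) * norm (y N p))" for N
  define \<epsilon> where "\<epsilon> N = (\<Sum>r\<in>P. \<Sum>p\<in>P. norm (b r p) * (\<Sum>q\<in>P. norm (e N p q)))" for N
  have e0: "(\<lambda>N. e N p q) \<longlonglongrightarrow> 0" if "p \<in> P" "q \<in> P" for p q
    using a[OF that] unfolding e_def by (simp add: LIM_zero)
  \<comment> \<open>The inverse of the limit matrix is applied to \<open>y\<close> minus the error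
    term; \<open>x\<close> still occurs on the right.\<close>
  have x_eq: "x N r = (\<Sum>p\<in>P. b r p * (y N p - (\<Sum>q\<in>P. e N p q * x N q)))"
    if yN: "\<forall>p\<in>P. y N p = (\<Sum>q\<in>P. a N p q * x N q)" and "r \<in> P" for N r
  proof -
    have "(\<Sum>q\<in>P. of_bool (le q p) * x N q) = y N p - (\<Sum>q\<in>P. e N p q * x N q)" if "p \<in> P" for p
      using yN that
      by (simp add: e_def sum_subtractf[symmetric] left_diff_distrib)
    then show ?thesis using b[OF that(2), of "x N"] by simp
  qed
  have err: "norm (\<Sum>q\<in>P. e N p q * x N q) \<le> (\<Sum>q\<in>P. norm (e N p q)) * s N" for N p
  proof -
    have "norm (e N p q * x N q) \<le> norm (e N p q) * s N" if "q \<in> P" for q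
      unfolding norm_mult s_def
      by (intro mult_left_mono member_le_sum that assms(1)) simp_all
    then show ?thesis unfolding sum_distrib_right by (rule sum_norm_le)
  qed
  have s_le: "s N \<le> Y N + \<epsilon> N * s N" if yN: "\<forall>p\<in>P. y N p = (\<Sum>q\<in>P. a N p q * x N q)" for N
  proof -
    have "norm (x N r) \<le> (\<Sum>p\<in>P. norm (b r p) * norm (y N p))
        + (\<Sum>p\<in>P. norm (b r p) * (\<Sum>q\<in>P. norm (e N p q))) * s N" if "r \<in> P" for r
    proof -
      have "norm (x N r) \<le> (\<Sum>p\<in>P. norm (b r p) * (norm (y N p) + (\<Sum>q\<in>P. norm (e N p q)) * s N))"
        unfolding x_eq[OF yN that]
      proof (rule sum_norm_le)
        fix p
        show "norm (b r p * (y N p - (\<Sum>q\<in>P. e N p q * x N q)))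
            \<le> norm (b r p) * (norm (y N p) + (\<Sum>q\<in>P. norm (e N p q)) * s N)"
          unfolding norm_mult
          by (intro mult_left_mono order_trans[OF norm_triangle_ineq4] add_left_mono err) simp
      qed
      then show ?thesis by (simp add: distrib_left sum.distrib sum_distrib_right mult.assoc)
    qed
    then have "s N \<le> (\<Sum>r\<in>P. (\<Sum>p\<in>P. norm (b r p) * norm (y N p))
        + (\<Sum>p\<in>P. norm (b r p) * (\<Sum>q\<in>P. norm (e N p q))) * s N)"
      unfolding s_def[of N] by (rule sum_mono)
    then show ?thesis by (simp add: Y_def \<epsilon>_def sum.distrib sum_distrib_right)
  qed
  have "\<epsilon> \<longlonglongrightarrow> (\<Sum>r\<in>P. \<Sum>p\<in>P. norm (b r p) * (\<Sum>q\<in>P. norm (0 :: complex)))"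
    unfolding \<epsilon>_def[abs_def] by (intro tendsto_sum tendsto_mult tendsto_const tendsto_norm e0)
  then have "\<epsilon> \<longlonglongrightarrow> 0" by simp
  then have \<epsilon>_small: "\<forall>\<^sub>F N in sequentially. \<epsilon> N < 1 / 2" by (rule order_tendstoD) simp
  have "convergent Y"
    unfolding Y_def[abs_def]
    by (intro convergent_sum convergent_mult convergent_const convergent_norm conv)
  then obtain K where K: "\<And>N. norm (Y N) \<le> K"
    using convergent_imp_Bseq BseqE by metis
  \<comment> \<open>Once \<open>\<epsilon> N\<close> is below 1/2, at most half of
    \<open>s N\<close> stands on the right of \<open>s_le\<close>, and absorbing it on the left
    costs the factor 2.\<close>
  have s_bound: "\<forall>\<^sub>F N in sequentially. s N \<le> 2 * K"
    using y \<epsilon>_small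
  proof eventually_elim
    case (elim N)
    have "0 \<le> s N" unfolding s_def by (intro sum_nonneg) simp
    then have "\<epsilon> N * s N \<le> 1 / 2 * s N" using elim by (intro mult_right_mono) simp_all
    then show ?case using s_le[OF elim(1)] K[of N] by simp
  qed
  have err0: "(\<lambda>N. \<Sum>q\<in>P. e N p q * x N q) \<longlonglongrightarrow> 0" if "p \<in> P" for p
  proof (rule tendsto_0_le[where K = "2 * K"])
    have "(\<lambda>N. \<Sum>q\<in>P. norm (e N p q)) \<longlonglongrightarrow> (\<Sum>q\<in>P. norm (0 :: complex))"
      using that by (intro tendsto_sum tendsto_norm e0)
    then show "(\<lambda>N. \<Sum>q\<in>P. norm (e N p q)) \<longlonglongrightarrow> 0" by simp
    show "\<forall>\<^sub>F N in sequentially. norm (\<Sum>q\<in>P. e N p q * x N q)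
        \<le> norm (\<Sum>q\<in>P. norm (e N p q)) * (2 * K)"
      using s_bound
    proof eventually_elim
      case (elim N)
      have nonneg: "0 \<le> (\<Sum>q\<in>P. norm (e N p q))" by (intro sum_nonneg norm_ge_zero)
      show ?case
        using order_trans[OF err mult_left_mono[OF elim nonneg]] nonneg by simp
    qed
  qed
  \<comment> \<open>With the solution bounded, the error disappears in the limit and only the limits
    of \<open>y\<close> remain.\<close>
  have "(\<lambda>N. \<Sum>p\<in>P. b r p * (y N p - (\<Sum>q\<in>P. e N p q * x N q)))
    \<longlonglongrightarrow> (\<Sum>p\<in>P. b r p * (lim (\<lambda>N. y N p) - 0))"
    using conv by (intro tendsto_sum tendsto_mult tendsto_const tendsto_diff err0)
      (simp_all add: convergent_LIMSEQ_iff)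
  moreover have "\<forall>\<^sub>F N in sequentially. (\<Sum>p\<in>P. b r p * (y N p - (\<Sum>q\<in>P. e N p q * x N q))) = x N r"
    using y by eventually_elim (rule x_eq[OF _ assms(7), symmetric])
  ultimately show ?thesis unfolding convergent_def by (blast intro: Lim_transform_eventually)
qed

text \<open>If q \<le> p and q \<noteq> p, then d(id,p) - d(id,q) = d(q,p) > 0, so the distance to
  the identity serves as the height \<open>h\<close>. The linear system is the passage from
  cumulants to moments, valid for \<open>N > 0\<close>.\<close>

lemma convergent_cumulant:
  assumes "converges_in_moments k E" "p \<in> Parts k"
  shows "convergent (\<lambda>N. cumulant k N p (E N))"
proof (rule convergent_solution[where P = "Parts k" and le = "geo_le k" and h = "pdist k (id_part k)"
      and a = "\<lambda>N p q. of_nat N powi (- defect k q p)" and y = "\<lambda>N p. moment k N p (E N)"])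
  show "geo_le k p p" if "p \<in> Parts k" for p
    using that defect_eq_0_iff[of p k p] by (simp add: defect_def nc_join nc_eq_ncomp)
  show "pdist k (id_part k) q < pdist k (id_part k) p"
    if "p \<in> Parts k" "q \<in> Parts k" "geo_le k q p" "q \<noteq> p" for p q
    using pdist_pos[of q k p] that by (simp add: geo_le_def)
  show "(\<lambda>N. of_nat N powi (- defect k q p)) \<longlonglongrightarrow> (of_bool (geo_le k q p) :: complex)"
    if "p \<in> Parts k" "q \<in> Parts k" for p q
    using powi_minus_tendsto[OF defect_nonneg[OF that]] that by (simp add: defect_eq_0_iff)
  show "\<forall>\<^sub>F N in sequentially. \<forall>p\<in>Parts k. moment k N p (E N) =
      (\<Sum>q\<in>Parts k. of_nat N powi (- defect k q p) * cumulant k N q (E N))"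
    using eventually_gt_at_top[of 0] by eventually_elim (simp add: moment_cumulant)
qed (use assms in \<open>auto simp: converges_in_moments_def\<close>)

theorem theorem5p9:
  fixes k :: nat and E F :: "nat \<Rightarrow> pvec"
  assumes "\<And>N. E N \<in> palg k" and "\<And>N. F N \<in> palg k"
    and "converges_in_moments k E" and "converges_in_moments k F"
  shows "converges_in_moments k (\<lambda>N. pmult k N (E N) (F N)) \<and>
    phi_kappa k (\<lambda>N. pmult k N (E N) (F N)) = boxtimes k (phi_kappa k E) (phi_kappa k F) \<and>
    phi_m k (\<lambda>N. pmult k N (E N) (F N)) = boxtimes_dm k (phi_kappa k E) (phi_m k F) \<and>
    phi_m k (\<lambda>N. pmult k N (E N) (F N)) = boxtimes_gm k (phi_m k E) (phi_kappa k F)"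
proof -
  let ?EF = "\<lambda>N. pmult k N (E N) (F N)"
  have cum: "(\<lambda>N. cumulant k N p (G N)) \<longlonglongrightarrow> phi_kappa k G (basis p)"
    if "converges_in_moments k G" "p \<in> Parts k" for G p
    using convergent_cumulant[OF that] that(2) by (simp add: phi_kappa_def lin_form_basis convergent_LIMSEQ_iff)
  have mom: "(\<lambda>N. moment k N p (G N)) \<longlonglongrightarrow> phi_m k G (basis p)"
    if "converges_in_moments k G" "p \<in> Parts k" for G p
    using that by (simp add: phi_m_def lin_form_basis converges_in_moments_def convergent_LIMSEQ_iff)
  \<comment> \<open>The factors of each term converge separately, and the power of \<open>N\<close>
    tends to 1 or 0 according to whether \<open>p1\<close> is below \<open>p\<close>. The same limit
    later gives the convergence in moments of the product.\<close>
  have left: "(\<lambda>N. moment k N p (?EF N)) \<longlonglongrightarrow> (\<Sum>p1 \<in> {p1 \<in> Parts k. geo_le k p1 p}.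
       phi_kappa k E (basis p1) * phi_m k F (basis (pcomp k (ptranspose p1) p)))"
    if p: "p \<in> Parts k" for p
  proof (rule Lim_transform_eventually)
    show "(\<lambda>N. \<Sum>p1\<in>Parts k. of_nat N powi (- defect k p1 p) * cumulant k N p1 (E N)
        * moment k N (pcomp k (ptranspose p1) p) (F N))
      \<longlonglongrightarrow> (\<Sum>p1 \<in> {p1 \<in> Parts k. geo_le k p1 p}.
       phi_kappa k E (basis p1) * phi_m k F (basis (pcomp k (ptranspose p1) p)))"
    proof -
      have "(\<lambda>N. \<Sum>p1\<in>Parts k. of_nat N powi (- defect k p1 p) * cumulant k N p1 (E N)
          * moment k N (pcomp k (ptranspose p1) p) (F N))
        \<longlonglongrightarrow> (\<Sum>p1\<in>Parts k. of_bool (defect k p1 p = 0) * phi_kappa k E (basis p1)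
          * phi_m k F (basis (pcomp k (ptranspose p1) p)))"
        using p assms(3,4)
        by (intro tendsto_sum tendsto_mult powi_minus_tendsto defect_nonneg cum mom pcomp_Parts) simp_all
      also have "(\<Sum>p1\<in>Parts k. of_bool (defect k p1 p = 0) * phi_kappa k E (basis p1)
          * phi_m k F (basis (pcomp k (ptranspose p1) p))) = (\<Sum>p1 \<in> {p1 \<in> Parts k. geo_le k p1 p}.
          phi_kappa k E (basis p1) * phi_m k F (basis (pcomp k (ptranspose p1) p)))"
        using p by (intro sum.mono_neutral_cong_right) (auto simp: defect_eq_0_iff)
      finally show ?thesis .
    qed
    show "\<forall>\<^sub>F N in sequentially. (\<Sum>p1\<in>Parts k. of_nat N powi (- defect k p1 p) * cumulant k N p1 (E N)
        * moment k N (pcomp k (ptranspose p1) p) (F N)) = moment k N p (?EF N)"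
      using eventually_gt_at_top[of 0] by eventually_elim (simp add: moment_pmult_left p)
  qed
  have right: "(\<lambda>N. moment k N p (?EF N)) \<longlonglongrightarrow> (\<Sum>p1 \<in> {p1 \<in> Parts k. geo_le k p1 p}.
       phi_m k E (basis (pcomp k p (ptranspose p1))) * phi_kappa k F (basis p1))"
    if p: "p \<in> Parts k" for p
  proof (rule Lim_transform_eventually)
    show "(\<lambda>N. \<Sum>p1\<in>Parts k. of_nat N powi (- defect k p1 p) * cumulant k N p1 (F N)
        * moment k N (pcomp k p (ptranspose p1)) (E N))
      \<longlonglongrightarrow> (\<Sum>p1 \<in> {p1 \<in> Parts k. geo_le k p1 p}.
       phi_m k E (basis (pcomp k p (ptranspose p1))) * phi_kappa k F (basis p1))"
    proof -
      have "(\<lambda>N. \<Sum>p1\<in>Parts k. of_nat N powi (- defect k p1 p) * cumulant k N p1 (F N)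
          * moment k N (pcomp k p (ptranspose p1)) (E N))
        \<longlonglongrightarrow> (\<Sum>p1\<in>Parts k. of_bool (defect k p1 p = 0) * phi_kappa k F (basis p1)
          * phi_m k E (basis (pcomp k p (ptranspose p1))))"
        using p assms(3,4)
        by (intro tendsto_sum tendsto_mult powi_minus_tendsto defect_nonneg cum mom pcomp_Parts) simp_all
      also have "(\<Sum>p1\<in>Parts k. of_bool (defect k p1 p = 0) * phi_kappa k F (basis p1)
          * phi_m k E (basis (pcomp k p (ptranspose p1)))) = (\<Sum>p1 \<in> {p1 \<in> Parts k. geo_le k p1 p}.
          phi_m k E (basis (pcomp k p (ptranspose p1))) * phi_kappa k F (basis p1))"
        using p by (intro sum.mono_neutral_cong_right) (auto simp: defect_eq_0_iff)
      finally show ?thesis .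
    qed
    show "\<forall>\<^sub>F N in sequentially. (\<Sum>p1\<in>Parts k. of_nat N powi (- defect k p1 p) * cumulant k N p1 (F N)
        * moment k N (pcomp k p (ptranspose p1)) (E N)) = moment k N p (?EF N)"
      using eventually_gt_at_top[of 0] by eventually_elim (simp add: moment_pmult_right p)
  qed
  \<comment> \<open>Obtained from the coordinates rather than from the moments of the product. On
    pairs with \<open>pcomp k p1 p2 = p\<close>, the vanishing of \<open>comp_defect\<close> is
    membership in \<open>Kset k p p1\<close>.\<close>
  have kappa: "(\<lambda>N. cumulant k N p (?EF N)) \<longlonglongrightarrow>
      (\<Sum>(p1, p2) \<in> {(p1, p2) \<in> Parts k \<times> Parts k. pcomp k p1 p2 = p \<and> p2 \<in> Kset k p p1}.
        phi_kappa k E (basis p1) * phi_kappa k F (basis p2))"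
    if p: "p \<in> Parts k" for p
  proof (rule Lim_transform_eventually)
    let ?L = "\<lambda>N. \<Sum>p1\<in>Parts k. \<Sum>p2\<in>Parts k. of_bool (pcomp k p1 p2 = p) *
      (of_nat N powi (- comp_defect k p1 p2) * cumulant k N p1 (E N) * cumulant k N p2 (F N))"
    have "?L \<longlonglongrightarrow> (\<Sum>p1\<in>Parts k. \<Sum>p2\<in>Parts k. of_bool (pcomp k p1 p2 = p) *
        (of_bool (comp_defect k p1 p2 = 0) * phi_kappa k E (basis p1) * phi_kappa k F (basis p2)))"
      using assms(3,4)
      by (intro tendsto_sum tendsto_mult tendsto_const powi_minus_tendsto comp_defect_nonneg cum) simp_all
    also have "(\<Sum>p1\<in>Parts k. \<Sum>p2\<in>Parts k. of_bool (pcomp k p1 p2 = p) *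
        (of_bool (comp_defect k p1 p2 = 0) * phi_kappa k E (basis p1) * phi_kappa k F (basis p2)))
      = (\<Sum>(p1, p2) \<in> Parts k \<times> Parts k. of_bool (pcomp k p1 p2 = p) *
        (of_bool (comp_defect k p1 p2 = 0) * phi_kappa k E (basis p1) * phi_kappa k F (basis p2)))"
      by (rule sum.cartesian_product)
    also have "\<dots> = (\<Sum>(p1, p2) \<in> {(p1, p2) \<in> Parts k \<times> Parts k. pcomp k p1 p2 = p \<and> p2 \<in> Kset k p p1}.
        phi_kappa k E (basis p1) * phi_kappa k F (basis p2))"
      by (intro sum.mono_neutral_cong_right) (auto simp: comp_defect_eq_0_iff)
    finally show "?L \<longlonglongrightarrow> \<dots>" .
    show "\<forall>\<^sub>F N in sequentially. ?L N = cumulant k N p (?EF N)"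
      using eventually_gt_at_top[of 0] by eventually_elim (simp add: cumulant_pmult)
  qed
  have "converges_in_moments k ?EF"
    unfolding converges_in_moments_def using left convergentI by blast
  moreover have "phi_kappa k ?EF = boxtimes k (phi_kappa k E) (phi_kappa k F)"
    unfolding phi_kappa_def[of k ?EF] boxtimes_def by (intro lin_form_cong limI kappa)
  moreover have "phi_m k ?EF = boxtimes_dm k (phi_kappa k E) (phi_m k F)"
    unfolding phi_m_def[of k ?EF] boxtimes_dm_def by (intro lin_form_cong limI left)
  moreover have "phi_m k ?EF = boxtimes_gm k (phi_m k E) (phi_kappa k F)"
    unfolding phi_m_def[of k ?EF] boxtimes_gm_def by (intro lin_form_cong limI right)
  ultimately show ?thesis by blast
qed

end
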